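(* The contravariant functors $\mathrm{at}$ and $\mathcal{P}$ restrict to a dual equivalence between the category $\mathbf{LCHMT}$ of locally compact Hausdorff MT-algebras and proper MT-morphisms and the category $\mathbf{LCHaus}$ of locally compact Hausdorff spaces and proper maps.
   Context: An MT-algebra is a pair $M=(B,\square)$ where $B$ is a complete boolean algebra and $\square:B\to B$ satisfies $\square 1=1$, $\square(a\wedge b)=\square a\wedge\square b$, $\square a\le a$, $\square a\le\square\square a$. An MT-morphism $f:M\to N$ is a complete boolean homomorphism with $f(\square_M a)\le\square_N f(a)$ for all $a$. Put $\diamond a=\neg\square\neg a$. An element $a$ is open if $a=\square a$; $\mathrm{O}(M)$ is the set of open elements. An element is saturated if it is a meet of open elements. $M$ is Hausdorff if every element of $M$ is a join of elements of $\mathrm{AC}(M)=\{a\in M\mid a=\bigwedge\{\diamond\square c\mid c\in M,\ a\le\square c\}\}$. An element $a$ is compact if for each $S\subseteq\mathrm{O}(M)$ with $a\le\bigvee S$ there is a finite $T\subseteq S$ with $a\le\bigvee T$; $\mathrm{KS}(M)$ is the set of compact saturated elements. For $a,b\in M$ write $a\vartriangleleft b$ if there is a compact $k$ with $a\le k\le b$. $M$ is locally compact if $u=\bigvee\{v\in\mathrm{O}(M)\mid v\vartriangleleft u\}$ for all $u\in\mathrm{O}(M)$. An MT-morphism $f:M\to N$ is proper if $a\in\mathrm{KS}(M)$ implies $f(a)\in\mathrm{KS}(N)$. A continuous map $f:X\to Y$ is proper if $f^{-1}(K)$ is compact for each compact saturated $K\subseteq Y$ (saturated = intersection of open sets). Functors: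 $\mathcal{P}$ sends a space $X$ to $(\mathcal{P}(X),\mathrm{int})$ (the powerset with the interior operator) and a map $f$ to $f^{-1}$. $\mathrm{at}$ sends $M$ to its set of atoms $\mathrm{at}(M)$ with topology $\{\eta(a)\mid a\in\mathrm{O}(M)\}$, where $\eta(a)=\{x\in\mathrm{at}(M)\mid x\le a\}$, and an MT-morphism $f:M\to N$ to $\mathrm{at}(f):\mathrm{at}(N)\to\mathrm{at}(M)$, the restriction to atoms of the left adjoint $f^*(x)=\bigwedge\{a\in M\mid x\le f(a)\}$. *)

theory Defs
  imports "HOL-Analysis.Analysis" "HOL-Algebra.Complete_Lattice"
begin

section \<open>MT-algebras\<close>

text \<open>
  Algebras and spaces have explicit carriers, so that the powerset of a space and the set of
  atoms of an algebra are again objects of the same kind. The class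
  \<^class>\<open>complete_boolean_algebra\<close> of the standard library is not used: it demands complete
  distributivity, which would force every algebra to be atomic.
\<close>

record 'a mt = "'a gorder" +
  Box :: "'a \<Rightarrow> 'a" (\<open>\<box>\<index> _\<close> [81] 80)

locale complete_boolean_lattice = complete_lattice +
  assumes meet_join_distrib:
    "\<lbrakk>x \<in> carrier L; y \<in> carrier L; z \<in> carrier L\<rbrakk>
      \<Longrightarrow> x \<sqinter> (y \<squnion> z) = (x \<sqinter> y) \<squnion> (x \<sqinter> z)"
    and complement_exists:
    "x \<in> carrier L \<Longrightarrow> \<exists>y\<in>carrier L. x \<sqinter> y = \<bottom> \<and> x \<squnion> y = \<top>"

definition compl_of :: "('a, 'b) gorder_scheme \<Rightarrow> 'a \<Rightarrow> 'a" (\<open>\<sim>\<index> _\<close> [81] 80)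
  where "\<sim>\<^bsub>L\<^esub> x = (THE y. y \<in> carrier L \<and> x \<sqinter>\<^bsub>L\<^esub> y = \<bottom>\<^bsub>L\<^esub> \<and> x \<squnion>\<^bsub>L\<^esub> y = \<top>\<^bsub>L\<^esub>)"

locale mt_algebra = complete_boolean_lattice M for M :: "'a mt" (structure) +
  assumes Box_closed: "a \<in> carrier M \<Longrightarrow> \<box> a \<in> carrier M"
    and Box_top: "\<box> \<top> = \<top>"
    and Box_meet: "\<lbrakk>a \<in> carrier M; b \<in> carrier M\<rbrakk> \<Longrightarrow> \<box> (a \<sqinter> b) = \<box> a \<sqinter> \<box> b"
    and Box_le: "a \<in> carrier M \<Longrightarrow> \<box> a \<sqsubseteq> a"
    and Box_Box: "a \<in> carrier M \<Longrightarrow> \<box> a \<sqsubseteq> \<box> (\<box> a)"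

definition Diamond :: "'a mt \<Rightarrow> 'a \<Rightarrow> 'a" (\<open>\<diamond>\<index> _\<close> [81] 80)
  where "\<diamond>\<^bsub>M\<^esub> a = \<sim>\<^bsub>M\<^esub> (\<box>\<^bsub>M\<^esub> (\<sim>\<^bsub>M\<^esub> a))"

definition mt_open :: "'a mt \<Rightarrow> 'a set"
  where "mt_open M = {a \<in> carrier M. a = \<box>\<^bsub>M\<^esub> a}"

definition mt_saturated :: "'a mt \<Rightarrow> 'a \<Rightarrow> bool"
  where "mt_saturated M a \<longleftrightarrow> (\<exists>S \<subseteq> mt_open M. a = \<Sqinter>\<^bsub>M\<^esub> S)"

definition mt_AC :: "'a mt \<Rightarrow> 'a set"
  where "mt_AC M = {a \<in> carrier M.
    a = \<Sqinter>\<^bsub>M\<^esub> {\<diamond>\<^bsub>M\<^esub> (\<box>\<^bsub>M\<^esub> c) |c. c \<in> carrier M \<and> a \<sqsubseteq>\<^bsub>M\<^esub> \<box>\<^bsub>M\<^esub> c}}"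

definition mt_Hausdorff :: "'a mt \<Rightarrow> bool"
  where "mt_Hausdorff M \<longleftrightarrow> (\<forall>b \<in> carrier M. \<exists>S \<subseteq> mt_AC M. b = \<Squnion>\<^bsub>M\<^esub> S)"

definition mt_compact :: "'a mt \<Rightarrow> 'a \<Rightarrow> bool"
  where "mt_compact M a \<longleftrightarrow> a \<in> carrier M \<and>
    (\<forall>S \<subseteq> mt_open M. a \<sqsubseteq>\<^bsub>M\<^esub> \<Squnion>\<^bsub>M\<^esub> S \<longrightarrow> (\<exists>T \<subseteq> S. finite T \<and> a \<sqsubseteq>\<^bsub>M\<^esub> \<Squnion>\<^bsub>M\<^esub> T))"

definition mt_KS :: "'a mt \<Rightarrow> 'a set"
  where "mt_KS M = {a. mt_compact M a \<and> mt_saturated M a}"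

definition mt_compactly_below :: "'a mt \<Rightarrow> 'a \<Rightarrow> 'a \<Rightarrow> bool"
  where "mt_compactly_below M a b \<longleftrightarrow> (\<exists>k. mt_compact M k \<and> a \<sqsubseteq>\<^bsub>M\<^esub> k \<and> k \<sqsubseteq>\<^bsub>M\<^esub> b)"

definition mt_locally_compact :: "'a mt \<Rightarrow> bool"
  where "mt_locally_compact M \<longleftrightarrow>
    (\<forall>u \<in> mt_open M. u = \<Squnion>\<^bsub>M\<^esub> {v \<in> mt_open M. mt_compactly_below M v u})"

section \<open>The two categories\<close>

text \<open>
  Morphisms are extensional functions (\<^const>\<open>undefined\<close> outside the carrier), so that
  equality of morphisms is equality in HOL. Identities are \<open>\<lambda>x\<in>A. x\<close> and composition is
  \<^const>\<open>compose\<close>. Source and target may live over different types.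
\<close>

definition mt_hom :: "'a mt \<Rightarrow> 'b mt \<Rightarrow> ('a \<Rightarrow> 'b) set"
  where "mt_hom M N = {f \<in> carrier M \<rightarrow>\<^sub>E carrier N.
    (\<forall>S \<subseteq> carrier M. f (\<Squnion>\<^bsub>M\<^esub> S) = \<Squnion>\<^bsub>N\<^esub> (f ` S)) \<and>
    (\<forall>S \<subseteq> carrier M. f (\<Sqinter>\<^bsub>M\<^esub> S) = \<Sqinter>\<^bsub>N\<^esub> (f ` S)) \<and>
    (\<forall>a \<in> carrier M. f (\<sim>\<^bsub>M\<^esub> a) = \<sim>\<^bsub>N\<^esub> (f a)) \<and>
    (\<forall>a \<in> carrier M. f (\<box>\<^bsub>M\<^esub> a) \<sqsubseteq>\<^bsub>N\<^esub> \<box>\<^bsub>N\<^esub> (f a))}"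

definition LCHMT :: "'a mt \<Rightarrow> bool"
  where "LCHMT M \<longleftrightarrow> mt_algebra M \<and> mt_Hausdorff M \<and> mt_locally_compact M"

definition LCHMT_hom :: "'a mt \<Rightarrow> 'b mt \<Rightarrow> ('a \<Rightarrow> 'b) set"
  where "LCHMT_hom M N = {f \<in> mt_hom M N. \<forall>a \<in> mt_KS M. f a \<in> mt_KS N}"

definition LCHMT_iso :: "'a mt \<Rightarrow> 'b mt \<Rightarrow> ('a \<Rightarrow> 'b) set"
  where "LCHMT_iso M N = {f \<in> LCHMT_hom M N. \<exists>g \<in> LCHMT_hom N M.
    compose (carrier M) g f = (\<lambda>a\<in>carrier M. a) \<and>
    compose (carrier N) f g = (\<lambda>b\<in>carrier N. b)}"

text \<open>Intersecting with \<^term>\<open>topspace X\<close> makes the empty intersection the whole space.\<close>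

definition saturatedin :: "'a topology \<Rightarrow> 'a set \<Rightarrow> bool"
  where "saturatedin X K \<longleftrightarrow> (\<exists>\<U>. (\<forall>U \<in> \<U>. openin X U) \<and> K = topspace X \<inter> \<Inter>\<U>)"

definition LCHaus :: "'a topology \<Rightarrow> bool"
  where "LCHaus X \<longleftrightarrow> locally_compact_space X \<and> Hausdorff_space X"

text \<open>
  Properness is meant in the following sense, not as \<^const>\<open>proper_map\<close> of the library (a
  closed, not necessarily continuous, map with compact fibres).
\<close>

definition LCHaus_hom :: "'a topology \<Rightarrow> 'b topology \<Rightarrow> ('a \<Rightarrow> 'b) set"
  where "LCHaus_hom X Y = {f \<in> topspace X \<rightarrow>\<^sub>E topspace Y. continuous_map X Y f \<and>
    (\<forall>K. compactin Y K \<and> saturatedin Y K \<longrightarrow> compactin X {x \<in> topspace X. f x \<in> K})}"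

definition LCHaus_iso :: "'a topology \<Rightarrow> 'b topology \<Rightarrow> ('a \<Rightarrow> 'b) set"
  where "LCHaus_iso X Y = {f \<in> LCHaus_hom X Y. \<exists>g \<in> LCHaus_hom Y X.
    compose (topspace X) g f = (\<lambda>x\<in>topspace X. x) \<and>
    compose (topspace Y) f g = (\<lambda>y\<in>topspace Y. y)}"

section \<open>The two contravariant functors\<close>

definition P_obj :: "'a topology \<Rightarrow> 'a set mt"
  where "P_obj X =
    \<lparr>carrier = Pow (topspace X), eq = (=), le = (\<subseteq>), Box = (\<lambda>A. X interior_of A)\<rparr>"

definition P_map :: "'a topology \<Rightarrow> 'b topology \<Rightarrow> ('a \<Rightarrow> 'b) \<Rightarrow> 'b set \<Rightarrow> 'a set"
  where "P_map X Y f = (\<lambda>B\<in>Pow (topspace Y). {x \<in> topspace X. f x \<in> B})"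

definition mt_atoms :: "'a mt \<Rightarrow> 'a set"
  where "mt_atoms M = {x \<in> carrier M. x \<noteq> \<bottom>\<^bsub>M\<^esub> \<and>
    (\<forall>y \<in> carrier M. y \<sqsubseteq>\<^bsub>M\<^esub> x \<longrightarrow> y = \<bottom>\<^bsub>M\<^esub> \<or> y = x)}"

definition mt_eta :: "'a mt \<Rightarrow> 'a \<Rightarrow> 'a set"
  where "mt_eta M = (\<lambda>a\<in>carrier M. {x \<in> mt_atoms M. x \<sqsubseteq>\<^bsub>M\<^esub> a})"

text \<open>
  For an MT-algebra the sets \<open>mt_eta M a\<close>, \<open>a\<close> open, do form a topology, so they are exactly the
  open sets of \<open>at_obj M\<close>, and its points are the atoms.
\<close>

definition at_obj :: "'a mt \<Rightarrow> 'a topology"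
  where "at_obj M = topology (\<lambda>U. U \<in> mt_eta M ` mt_open M)"

definition at_map :: "'a mt \<Rightarrow> 'b mt \<Rightarrow> ('a \<Rightarrow> 'b) \<Rightarrow> 'b \<Rightarrow> 'a"
  where "at_map M N f = (\<lambda>x\<in>mt_atoms N. \<Sqinter>\<^bsub>M\<^esub> {a \<in> carrier M. x \<sqsubseteq>\<^bsub>N\<^esub> f a})"

definition space_eps :: "'a topology \<Rightarrow> 'a \<Rightarrow> 'a set"
  where "space_eps X = (\<lambda>x\<in>topspace X. {x})"

end

theory Submission
  imports Defs
begin

text \<open>
  A locally compact Hausdorff MT-algebra \<open>M\<close> is atomic. Below a nonzero element there is a nonzero
  element of \<open>AC(M)\<close> which moreover lies below a compact element; it is closed, so by
  compactness and Zorn's lemma there is a minimal nonzero closed element below it. As every nonzero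
  element contains a nonzero closed one, this minimal closed element is an atom. Hence \<open>\<eta>\<close> is
  an isomorphism from \<open>M\<close> onto the powerset of its atoms that preserves the interior operator in
  both directions, and it transports compactness, saturation, separation and local compactness. The
  adjunction \<open>f\<^sup>*(x) \<le> a \<longleftrightarrow> x \<le> f(a)\<close> makes the preimage of \<open>\<eta>(a)\<close> under
  \<open>at(f)\<close> equal to \<open>\<eta>(f(a))\<close>, which gives continuity, properness and naturality at once.
\<close>

section \<open>Complete Boolean lattices\<close>

text \<open>A complete Boolean algebra may have no atoms, so the points have to be produced by the
  topology. Zorn's lemma fails for arbitrary nonzero elements, since a descending chain of them may
  have meet \<open>\<bottom>\<close>. Closed elements below a compact one are the right substitute:
  there a vanishing meet would yield a finite subcover, hence a vanishing member of the chain.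
  Hausdorffness is used twice. It supplies closed elements below every nonzero element; and once
  atoms exist, the nonzero element of \<open>mt_AC M\<close> found below an atom must be that atom,
  so every atom is the meet of the closures of its open neighbourhoods, which is separation of
  points. Complete distributivity is replaced throughout by a weaker fact: an element disjoint from
  every member of a family is disjoint from its join. Properness tests only compact saturated sets,
  so for composites and for preimage maps it has to be combined with the fact that continuous
  preimages of saturated sets are saturated.\<close>

context complete_boolean_lattice
begin

text \<open>Justifies the definite description in \<open>compl_of\<close>. An element disjoint from
  \<open>x\<close> lies below any element that joins with \<open>x\<close> to \<open>\<top>\<close>,
  by distributivity; this is applied in both directions.\<close>

lemma compl_unique:
  assumes "x \<in> carrier L" "y \<in> carrier L" "x \<sqinter> y = \<bottom>" "x \<squnion> y = \<top>"
    and "z \<in> carrier L" "x \<sqinter> z = \<bottom>" "x \<squnion> z = \<top>"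
  shows "y = z"
proof -
  have le: "a \<sqsubseteq> b" if "a \<in> carrier L" "b \<in> carrier L" "x \<sqinter> a = \<bottom>" "x \<squnion> b = \<top>" for a b
  proof -
    have "a = a \<sqinter> (x \<squnion> b)"
      using that top_meet[of a] by (simp add: meet_comm[of L a] eq_is_equal)
    also have "\<dots> = (a \<sqinter> x) \<squnion> (a \<sqinter> b)"
      using that assms(1) by (intro meet_join_distrib)
    also have "\<dots> = a \<sqinter> b"
      using that assms(1) bottom_join[of "a \<sqinter> b"] by (simp add: meet_comm[of L a x] eq_is_equal)
    finally show ?thesis
      using that le_iff_join by simp
  qed
  show ?thesis
    using assms by (auto intro!: le_antisym[OF le le])
qed

lemma compl_props:
  assumes "x \<in> carrier L"
  shows compl_closed [simp]: "\<sim> x \<in> carrier L"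
    and meet_compl: "x \<sqinter> \<sim> x = \<bottom>"
    and join_compl: "x \<squnion> \<sim> x = \<top>"
proof -
  obtain y where y: "y \<in> carrier L \<and> x \<sqinter> y = \<bottom> \<and> x \<squnion> y = \<top>"
    using complement_exists[OF assms] by blast
  have "\<sim> x \<in> carrier L \<and> x \<sqinter> \<sim> x = \<bottom> \<and> x \<squnion> \<sim> x = \<top>"
    unfolding compl_of_def by (rule theI[where a = y]) (use y compl_unique[OF assms] in \<open>simp; fail | metis\<close>)+
  then show "\<sim> x \<in> carrier L" "x \<sqinter> \<sim> x = \<bottom>" "x \<squnion> \<sim> x = \<top>"
    by auto
qed

lemma compl_eqI:
  assumes "x \<in> carrier L" "y \<in> carrier L" "x \<sqinter> y = \<bottom>" "x \<squnion> y = \<top>"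
  shows "\<sim> x = y"
  using compl_unique[OF assms(1) compl_closed meet_compl join_compl] assms by simp

lemma compl_compl [simp]:
  assumes "x \<in> carrier L"
  shows "\<sim> (\<sim> x) = x"
  using assms meet_compl[OF assms] join_compl[OF assms]
  by (intro compl_eqI) (simp_all add: meet_comm[of L "\<sim> x"] join_comm[of L "\<sim> x"])

lemma eq_bottom: "x \<in> carrier L \<Longrightarrow> x \<sqsubseteq> \<bottom> \<Longrightarrow> x = \<bottom>"
  by (simp add: le_antisym)

lemma le_compl_iff:
  assumes "x \<in> carrier L" "y \<in> carrier L"
  shows "x \<sqsubseteq> \<sim> y \<longleftrightarrow> x \<sqinter> y = \<bottom>"
proof
  assume "x \<sqsubseteq> \<sim> y"
  then have "x \<sqinter> y \<sqsubseteq> y \<sqinter> \<sim> y"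
    using assms by (meson compl_closed le_trans meet_closed meet_le meet_left meet_right)
  then show "x \<sqinter> y = \<bottom>"
    using assms by (simp add: meet_compl eq_bottom)
next
  assume *: "x \<sqinter> y = \<bottom>"
  have "x = x \<sqinter> (y \<squnion> \<sim> y)"
    using assms top_meet[of x] by (simp add: join_compl meet_comm[of L x] eq_is_equal)
  also have "\<dots> = (x \<sqinter> y) \<squnion> (x \<sqinter> \<sim> y)"
    using assms by (simp add: meet_join_distrib)
  also have "\<dots> = x \<sqinter> \<sim> y"
    using assms * bottom_join[of "x \<sqinter> \<sim> y"] by (simp add: eq_is_equal)
  finally show "x \<sqsubseteq> \<sim> y"
    using assms by (metis compl_closed meet_right)
qed

lemma le_compl_swap:
  "x \<in> carrier L \<Longrightarrow> y \<in> carrier L \<Longrightarrow> x \<sqsubseteq> \<sim> y \<longleftrightarrow> y \<sqsubseteq> \<sim> x"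
  by (simp add: le_compl_iff meet_comm)

lemma compl_mono_iff:
  "x \<in> carrier L \<Longrightarrow> y \<in> carrier L \<Longrightarrow> \<sim> x \<sqsubseteq> \<sim> y \<longleftrightarrow> y \<sqsubseteq> x"
  by (subst le_compl_swap) auto

lemma le_compl_self: "x \<in> carrier L \<Longrightarrow> x \<sqsubseteq> \<sim> x \<Longrightarrow> x = \<bottom>"
  using le_compl_iff[of x x] le_iff_join[of x x] by simp

text \<open>If \<open>b\<close> were disjoint from every member, \<open>\<sim> b\<close> would be an
  upper bound of \<open>S\<close>, so \<open>b\<close> would lie below its own complement. This
  serves in place of an infinite distributive law.\<close>

lemma le_Sup_meets:
  assumes S: "S \<subseteq> carrier L" and b: "b \<in> carrier L" "b \<noteq> \<bottom>" "b \<sqsubseteq> \<Squnion> S"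
  shows "\<exists>s\<in>S. b \<sqinter> s \<noteq> \<bottom>"
proof (rule ccontr)
  assume *: "\<not> ?thesis"
  have "s \<sqsubseteq> \<sim> b" if "s \<in> S" for s
    using that * S b le_compl_iff[of s b] meet_comm[of L s b] by auto
  then have "\<Squnion> S \<sqsubseteq> \<sim> b"
    using S b by (intro sup_least) auto
  then have "b \<sqsubseteq> \<sim> b"
    using S b le_trans[of b "\<Squnion> S" "\<sim> b"] by simp
  then show False
    using b le_compl_self by simp
qed

text \<open>Complementation is an order-reversing involution, so it exchanges lower bounds of
  \<open>S\<close> with upper bounds of the complements.\<close>

lemma compl_Inf:
  assumes "S \<subseteq> carrier L"
  shows "\<sim> (\<Sqinter> S) = \<Squnion> (compl_of L ` S)"
proof (rule le_antisym)
  let ?J = "\<Squnion> (compl_of L ` S)"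
  have S': "compl_of L ` S \<subseteq> carrier L" and J: "?J \<in> carrier L"
    using assms by (auto intro!: sup_closed)
  have compl_J: "\<sim> ?J \<sqsubseteq> x \<longleftrightarrow> \<sim> x \<sqsubseteq> ?J" if "x \<in> carrier L" for x
    using compl_mono_iff[of ?J "\<sim> x"] J that by simp
  have "\<sim> ?J \<sqsubseteq> s" if "s \<in> S" for s
  proof -
    have "\<sim> s \<sqsubseteq> ?J"
      using S' that by (intro sup_upper) auto
    then show ?thesis
      using compl_J assms that by auto
  qed
  then have "\<sim> ?J \<sqsubseteq> \<Sqinter> S"
    using assms S' by (intro inf_greatest) auto
  then show "\<sim> (\<Sqinter> S) \<sqsubseteq> ?J"
    using compl_J assms by simp
  show "?J \<sqsubseteq> \<sim> (\<Sqinter> S)"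
    using assms S' by (intro sup_least) (auto simp: compl_mono_iff inf_lower subsetD)
  show "\<sim> (\<Sqinter> S) \<in> carrier L" "?J \<in> carrier L"
    using assms S' by auto
qed

lemma compl_bottom: "\<sim> \<bottom> = \<top>"
  using bottom_meet[of \<top>] bottom_join[of \<top>] by (intro compl_eqI) (simp_all add: eq_is_equal)

lemma sup_empty: "\<Squnion> {} = \<bottom>"
  using weak_sup_empty by (simp add: eq_is_equal)

end


section \<open>Open and closed elements, atoms\<close>

text \<open>Phrased through the complement rather than as a fixpoint of \<open>Diamond\<close>, so
  that De Morgan turns joins of open elements into meets of closed ones.\<close>

definition mt_closed :: "'a mt \<Rightarrow> 'a set"
  where "mt_closed M = {a \<in> carrier M. \<sim>\<^bsub>M\<^esub> a \<in> mt_open M}"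

context mt_algebra
begin

lemma open_carrier: "mt_open M \<subseteq> carrier M"
  by (auto simp: mt_open_def)

lemma Box_mono:
  assumes "a \<in> carrier M" "b \<in> carrier M" "a \<sqsubseteq> b"
  shows "\<box> a \<sqsubseteq> \<box> b"
proof -
  have "\<box> a = \<box> a \<sqinter> \<box> b"
    using assms Box_meet[of a b] le_iff_join[of a b] by simp
  then show ?thesis
    using assms le_iff_join[of "\<box> a" "\<box> b"] Box_closed by simp
qed

lemma Box_open: "a \<in> carrier M \<Longrightarrow> \<box> a \<in> mt_open M"
  using le_antisym[OF Box_Box Box_le[OF Box_closed]] by (simp add: mt_open_def Box_closed)

lemma open_le_Box:
  assumes "u \<in> mt_open M" "a \<in> carrier M" "u \<sqsubseteq> a"
  shows "u \<sqsubseteq> \<box> a"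
  using Box_mono[of u a] assms by (simp add: mt_open_def)

lemma openI:
  assumes "a \<in> carrier M" "a \<sqsubseteq> \<box> a"
  shows "a \<in> mt_open M"
  using le_antisym[OF assms(2) Box_le] assms Box_closed by (simp add: mt_open_def)

text \<open>Each member of \<open>S\<close> is open and below \<open>\<Squnion> S\<close>, hence
  below \<open>\<box> (\<Squnion> S)\<close>; so the join is below it too.\<close>

lemma open_Sup:
  assumes "S \<subseteq> mt_open M"
  shows "\<Squnion> S \<in> mt_open M"
proof -
  have S: "S \<subseteq> carrier M"
    using assms open_carrier by blast
  have "\<Squnion> S \<sqsubseteq> \<box> (\<Squnion> S)"
    using S assms by (intro sup_least Box_closed sup_closed open_le_Box sup_upper) auto
  then show ?thesis
    using S by (intro openI) auto
qed

lemma open_meet: "u \<in> mt_open M \<Longrightarrow> v \<in> mt_open M \<Longrightarrow> u \<sqinter> v \<in> mt_open M"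
  by (auto simp: mt_open_def Box_meet)

lemma open_top: "\<top> \<in> mt_open M"
  by (simp add: mt_open_def Box_top)

lemma closed_carrier: "mt_closed M \<subseteq> carrier M"
  by (auto simp: mt_closed_def)

lemma closed_Inf:
  assumes "S \<subseteq> mt_closed M"
  shows "\<Sqinter> S \<in> mt_closed M"
proof -
  have "S \<subseteq> carrier M" "compl_of M ` S \<subseteq> mt_open M"
    using assms by (auto simp: mt_closed_def)
  then show ?thesis
    using compl_Inf open_Sup by (simp add: mt_closed_def)
qed

lemma Diamond_closed: "a \<in> carrier M \<Longrightarrow> \<diamond> a \<in> mt_closed M"
  by (simp add: mt_closed_def Diamond_def Box_closed Box_open)

text \<open>Such an element is a meet of elements \<open>\<diamond> (\<box> c)\<close>, the closures
  of its open neighbourhoods, and closed elements are stable under meets.\<close>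

lemma AC_closed:
  assumes "a \<in> mt_AC M"
  shows "a \<in> mt_closed M"
proof -
  have "a = \<Sqinter> {\<diamond> (\<box> c) |c. c \<in> carrier M \<and> a \<sqsubseteq> \<box> c}"
    using assms by (simp add: mt_AC_def)
  also have "\<dots> \<in> mt_closed M"
    using Diamond_closed Box_closed by (intro closed_Inf) auto
  finally show ?thesis .
qed

lemma atoms_carrier: "mt_atoms M \<subseteq> carrier M"
  by (auto simp: mt_atoms_def)

lemma atom_meet:
  assumes "x \<in> mt_atoms M" "a \<in> carrier M" "x \<sqinter> a \<noteq> \<bottom>"
  shows "x \<sqsubseteq> a"
proof -
  have x: "x \<in> carrier M"
    using assms atoms_carrier by blast
  then have "x \<sqinter> a = x"
    using assms meet_left[of x a] by (auto simp: mt_atoms_def)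
  then show ?thesis
    using x assms meet_right[of x a] by simp
qed

lemma atom_le_compl_iff:
  assumes "x \<in> mt_atoms M" "a \<in> carrier M"
  shows "x \<sqsubseteq> \<sim> a \<longleftrightarrow> \<not> x \<sqsubseteq> a"
proof -
  have "x \<in> carrier M" "x \<noteq> \<bottom>"
    using assms by (auto simp: mt_atoms_def)
  then show ?thesis
    using assms le_compl_iff[of x a] atom_meet[of x a] le_iff_join[of x a] by auto
qed

text \<open>Atoms are completely join-prime: below a join, an atom meets some member, and an atom
  that meets an element lies below it.\<close>

lemma atom_le_Sup_iff:
  assumes x: "x \<in> mt_atoms M" and S: "S \<subseteq> carrier M"
  shows "x \<sqsubseteq> \<Squnion> S \<longleftrightarrow> (\<exists>s\<in>S. x \<sqsubseteq> s)"
proof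
  assume "x \<sqsubseteq> \<Squnion> S"
  then obtain s where "s \<in> S" "x \<sqinter> s \<noteq> \<bottom>"
    using le_Sup_meets[OF S, of x] x by (auto simp: mt_atoms_def)
  then show "\<exists>s\<in>S. x \<sqsubseteq> s"
    using atom_meet[OF x] S by blast
next
  assume "\<exists>s\<in>S. x \<sqsubseteq> s"
  then obtain s where "s \<in> S" "x \<sqsubseteq> s" by blast
  then show "x \<sqsubseteq> \<Squnion> S"
    using le_trans[of x s "\<Squnion> S"] sup_upper[OF S, of s] S subsetD[OF atoms_carrier x] by auto
qed

lemma le_Inf_iff:
  assumes x: "x \<in> carrier M" and S: "S \<subseteq> carrier M"
  shows "x \<sqsubseteq> \<Sqinter> S \<longleftrightarrow> (\<forall>s\<in>S. x \<sqsubseteq> s)"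
proof
  assume "x \<sqsubseteq> \<Sqinter> S"
  then show "\<forall>s\<in>S. x \<sqsubseteq> s"
    using le_trans[of x "\<Sqinter> S"] inf_lower[OF S] x S by auto
qed (use x S inf_greatest in auto)

lemma atom_eq_if_le:
  assumes "x \<in> mt_atoms M" "y \<in> mt_atoms M" "x \<sqsubseteq> y"
  shows "x = y"
  using assms by (auto simp: mt_atoms_def)

section \<open>Atomicity\<close>

lemma Hausdorff_AC_below:
  assumes H: "mt_Hausdorff M" and b: "b \<in> carrier M" "b \<noteq> \<bottom>"
  obtains a where "a \<in> mt_AC M" "a \<noteq> \<bottom>" "a \<sqsubseteq> b"
proof -
  obtain S where S: "S \<subseteq> mt_AC M" "b = \<Squnion> S"
    using H b by (auto simp: mt_Hausdorff_def)
  have Sc: "S \<subseteq> carrier M"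
    using S by (auto simp: mt_AC_def)
  \<comment> \<open>Both subsets of \<open>{\<bottom>}\<close>, the empty one included, have join
    \<open>\<bottom>\<close>.\<close>
  have "\<not> S \<subseteq> {\<bottom>}"
    using sup_empty S(2) b sup_of_singleton[of \<bottom>] by (auto simp: subset_singleton_iff)
  then obtain a where "a \<in> S" "a \<noteq> \<bottom>" by blast
  then show ?thesis
    using that S sup_upper[OF Sc] by auto
qed

text \<open>The finite intersection property, relative to \<open>k\<close>: if the meet vanished,
  the complements would be an open cover of \<open>k\<close>. The least element of a finite
  subfamily lies below \<open>k\<close>, hence below its own complement.\<close>

lemma closed_chain_Inf_nonzero:
  assumes k: "mt_compact M k" and C: "C \<subseteq> mt_closed M" "C \<noteq> {}"
    and nz: "\<And>c. c \<in> C \<Longrightarrow> c \<noteq> \<bottom> \<and> c \<sqsubseteq> k"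
    and chain: "\<And>c d. c \<in> C \<Longrightarrow> d \<in> C \<Longrightarrow> c \<sqsubseteq> d \<or> d \<sqsubseteq> c"
  shows "\<Sqinter> C \<noteq> \<bottom>"
proof
  assume "\<Sqinter> C = \<bottom>"
  have Cc: "C \<subseteq> carrier M" and kc: "k \<in> carrier M"
    using C closed_carrier k by (auto simp: mt_compact_def)
  have "compl_of M ` C \<subseteq> mt_open M"
    using C by (auto simp: mt_closed_def)
  moreover have "k \<sqsubseteq> \<Squnion> (compl_of M ` C)"
    using compl_Inf[OF Cc] \<open>\<Sqinter> C = \<bottom>\<close> kc compl_bottom top_higher[of k] by simp
  ultimately obtain T where T: "T \<subseteq> compl_of M ` C" "finite T" "k \<sqsubseteq> \<Squnion> T"
    using k unfolding mt_compact_def by blast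
  then obtain F where F: "F \<subseteq> C" "finite F" "T = compl_of M ` F"
    by (meson finite_subset_image)
  \<comment> \<open>The lower bound is taken in \<open>C\<close>, not in \<open>F\<close>, so that
    an empty \<open>F\<close> is covered; this is where \<open>C\<close> has to be nonempty.\<close>
  have "\<exists>m\<in>C. \<forall>c\<in>F. m \<sqsubseteq> c"
    using F(2,1)
  proof (induction F rule: finite_induct)
    case empty
    then show ?case using C by auto
  next
    case (insert x F)
    then obtain m where m: "m \<in> C" "\<forall>c\<in>F. m \<sqsubseteq> c" by auto
    have x: "x \<in> C" and in_carrier: "x \<in> carrier M" "m \<in> carrier M" "F \<subseteq> carrier M"
      using insert m Cc by auto
    show ?case
    proof (cases "m \<sqsubseteq> x")
      case True
      then show ?thesis using m by auto
    next
      case False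
      then have "x \<sqsubseteq> m" using chain x m by blast
      then have "\<forall>c\<in>F. x \<sqsubseteq> c"
        using m(2) in_carrier le_trans[of x m] by auto
      then show ?thesis using x in_carrier by auto
    qed
  qed
  then obtain m where m: "m \<in> C" "\<forall>c\<in>F. m \<sqsubseteq> c" by blast
  have mc: "m \<in> carrier M" using m Cc by auto
  have Fc: "F \<subseteq> carrier M" using F Cc by auto
  have Tc: "T \<subseteq> carrier M" using F(3) Fc by auto
  have "\<Squnion> T \<sqsubseteq> \<sim> m"
    unfolding F(3) using m mc Fc by (intro sup_least) (auto simp: compl_mono_iff)
  then have "k \<sqsubseteq> \<sim> m"
    using T(3) Tc kc mc le_trans[of k "\<Squnion> T" "\<sim> m"] by simp
  then have "m \<sqsubseteq> \<sim> m"
    using nz[OF m(1)] kc mc le_trans[of m k "\<sim> m"] by simp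
  then show False
    using le_compl_self[OF mc] nz[OF m(1)] by auto
qed

lemma minimal_closed_below_compact:
  assumes k: "mt_compact M k" and a: "a \<in> mt_closed M" "a \<noteq> \<bottom>" "a \<sqsubseteq> k"
  obtains m where "m \<in> mt_closed M" "m \<noteq> \<bottom>" "m \<sqsubseteq> a"
    "\<And>c. c \<in> mt_closed M \<Longrightarrow> c \<noteq> \<bottom> \<Longrightarrow> c \<sqsubseteq> m \<Longrightarrow> c = m"
proof -
  let ?A = "{c \<in> mt_closed M. c \<noteq> \<bottom> \<and> c \<sqsubseteq> a}"
  \<comment> \<open>Zorn's lemma delivers maximal elements, so the order is reversed. A nonempty
    chain is bounded by its meet, the empty chain by \<open>a\<close>.\<close>
  let ?P = "\<lambda>c d. d \<sqsubseteq> c"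
  have A: "?A \<subseteq> carrier M" and ac: "a \<in> carrier M" and kc: "k \<in> carrier M"
    using closed_carrier a k by (auto simp: mt_compact_def)
  have "partial_order_on ?A (relation_of ?P ?A)"
    using A by (intro partial_order_on_relation_ofI) (auto intro: le_trans le_antisym)
  moreover have "\<exists>u\<in>?A. \<forall>c\<in>C. u \<sqsubseteq> c" if C: "C \<in> Chains (relation_of ?P ?A)" for C
  proof (cases "C = {}")
    case True
    then show ?thesis using a ac by auto
  next
    case False
    have CA: "C \<subseteq> ?A" and chain: "\<And>c d. c \<in> C \<Longrightarrow> d \<in> C \<Longrightarrow> c \<sqsubseteq> d \<or> d \<sqsubseteq> c"
      using C by (auto simp: Chains_def relation_of_def)
    have Cc: "C \<subseteq> carrier M" using CA A by blast
    have Ck: "c \<sqsubseteq> k" if "c \<in> C" for c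
      using subsetD[OF CA that] subsetD[OF Cc that] ac kc a le_trans[of c a k] by simp
    have "\<Sqinter> C \<noteq> \<bottom>"
      using CA Ck False chain by (intro closed_chain_Inf_nonzero[OF k]) auto
    moreover have "\<Sqinter> C \<in> mt_closed M"
      using CA by (intro closed_Inf) auto
    moreover obtain c where c: "c \<in> C" using False by blast
    have "\<Sqinter> C \<sqsubseteq> a"
      using le_trans[of "\<Sqinter> C" c a] inf_lower[OF Cc c] subsetD[OF CA c] subsetD[OF Cc c] Cc ac by simp
    ultimately show ?thesis
      using inf_lower[OF Cc] by auto
  qed
  ultimately obtain m where m: "m \<in> ?A" "\<forall>c\<in>?A. c \<sqsubseteq> m \<longrightarrow> c = m"
    using predicate_Zorn[of ?A ?P] by blast
  have "c = m" if "c \<in> mt_closed M" "c \<noteq> \<bottom>" "c \<sqsubseteq> m" for c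
  proof -
    have "c \<sqsubseteq> a"
      using le_trans[of c m a] that m(1) ac subsetD[OF closed_carrier] by simp
    then show ?thesis
      using that m(2) by simp
  qed
  then show ?thesis
    using that m(1) by auto
qed

lemma LCHMT_atomic:
  assumes H: "mt_Hausdorff M" and LC: "mt_locally_compact M"
    and b: "b \<in> carrier M" "b \<noteq> \<bottom>"
  obtains x where "x \<in> mt_atoms M" "x \<sqsubseteq> b"
proof -
  let ?V = "{v \<in> mt_open M. mt_compactly_below M v \<top>}"
  have V: "?V \<subseteq> carrier M" using open_carrier by auto
  \<comment> \<open>Local compactness at the open element \<open>\<top>\<close>: the open elements
    with a compact element above them join to \<open>\<top>\<close>, so one of them meets
    \<open>b\<close>.\<close>
  have "\<top> = \<Squnion> ?V"
    using LC open_top by (simp add: mt_locally_compact_def)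
  then have "b \<sqsubseteq> \<Squnion> ?V" using b by simp
  then obtain v where v: "v \<in> ?V" "b \<sqinter> v \<noteq> \<bottom>"
    using le_Sup_meets[OF V] b by blast
  then obtain k where k: "mt_compact M k" "v \<sqsubseteq> k"
    by (auto simp: mt_compactly_below_def)
  have kc: "k \<in> carrier M" and vc: "v \<in> carrier M"
    using k v V by (auto simp: mt_compact_def)
  obtain a where a: "a \<in> mt_AC M" "a \<noteq> \<bottom>" "a \<sqsubseteq> b \<sqinter> v"
    using Hausdorff_AC_below[OF H _ v(2)] b vc by auto
  have ac: "a \<in> carrier M" using a by (simp add: mt_AC_def)
  have "a \<sqsubseteq> b" "a \<sqsubseteq> v"
    using le_trans[OF a(3) meet_left] le_trans[OF a(3) meet_right] ac b vc by auto
  then have "a \<sqsubseteq> k"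
    using le_trans[of a v k] k ac vc kc by simp
  obtain m where m: "m \<in> mt_closed M" "m \<noteq> \<bottom>" "m \<sqsubseteq> a"
    and min: "\<And>c. c \<in> mt_closed M \<Longrightarrow> c \<noteq> \<bottom> \<Longrightarrow> c \<sqsubseteq> m \<Longrightarrow> c = m"
    using minimal_closed_below_compact[OF k(1) AC_closed[OF a(1)] a(2) \<open>a \<sqsubseteq> k\<close>] by metis
  have mc: "m \<in> carrier M" using m closed_carrier by auto
  \<comment> \<open>\<open>y\<close> need not be closed, so minimality of \<open>m\<close> does not
    apply to it directly; a nonzero closed \<open>c\<close> below \<open>y\<close> is forced to be
    \<open>m\<close>, which squeezes \<open>y\<close>.\<close>
  have "y = m" if y: "y \<in> carrier M" "y \<sqsubseteq> m" "y \<noteq> \<bottom>" for y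
  proof -
    obtain c where c: "c \<in> mt_AC M" "c \<noteq> \<bottom>" "c \<sqsubseteq> y"
      using Hausdorff_AC_below[OF H y(1,3)] by auto
    then have cc: "c \<in> carrier M" by (simp add: mt_AC_def)
    have "c \<sqsubseteq> m" using le_trans[of c y m] c y cc mc by simp
    then have "c = m" using min AC_closed c by blast
    then show ?thesis using c y mc le_antisym[of y m] by simp
  qed
  then have "m \<in> mt_atoms M" using m mc by (auto simp: mt_atoms_def)
  moreover have "m \<sqsubseteq> b"
    using le_trans[of m a b] m \<open>a \<sqsubseteq> b\<close> mc ac b by simp
  ultimately show ?thesis using that by blast
qed

end

section \<open>The space of atoms\<close>

context mt_algebra
begin

lemma eta_apply: "a \<in> carrier M \<Longrightarrow> mt_eta M a = {x \<in> mt_atoms M. x \<sqsubseteq> a}"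
  by (simp add: mt_eta_def)

lemma eta_meet:
  assumes "a \<in> carrier M" "b \<in> carrier M"
  shows "mt_eta M (a \<sqinter> b) = mt_eta M a \<inter> mt_eta M b"
proof -
  have "x \<sqsubseteq> a \<sqinter> b \<longleftrightarrow> x \<sqsubseteq> a \<and> x \<sqsubseteq> b" if "x \<in> mt_atoms M" for x
    using le_Inf_iff[of x "{a, b}"] assms subsetD[OF atoms_carrier that] by (simp add: meet_def)
  then show ?thesis
    using assms by (auto simp: eta_apply)
qed

text \<open>This is join-primeness of atoms. It makes the images of open elements stable under
  unions, and later makes \<open>mt_eta\<close> surjective.\<close>

lemma eta_Sup:
  assumes "S \<subseteq> carrier M"
  shows "mt_eta M (\<Squnion> S) = (\<Union>s\<in>S. mt_eta M s)"
proof -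
  have "mt_eta M s = {x \<in> mt_atoms M. x \<sqsubseteq> s}" if "s \<in> S" for s
    using that assms eta_apply by blast
  moreover have "mt_eta M (\<Squnion> S) = {x \<in> mt_atoms M. \<exists>s\<in>S. x \<sqsubseteq> s}"
    using assms atom_le_Sup_iff[OF _ assms] by (simp add: eta_apply cong: conj_cong)
  ultimately show ?thesis by auto
qed

lemma eta_atom:
  assumes x: "x \<in> mt_atoms M"
  shows "mt_eta M x = {x}"
proof -
  have "x \<in> carrier M" using x atoms_carrier by blast
  then show ?thesis
    using x atom_eq_if_le[OF _ x] by (auto simp: eta_apply)
qed

lemma eta_top: "mt_eta M \<top> = mt_atoms M"
  using subsetD[OF atoms_carrier] by (auto simp: eta_apply)

text \<open>The proof obligation behind \<open>at_obj\<close>: the constructor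
  \<open>topology\<close> can be unfolded only for predicates of this kind.\<close>

lemma istopology_eta: "istopology (\<lambda>U. U \<in> mt_eta M ` mt_open M)"
  unfolding istopology_def
proof (intro conjI allI impI)
  fix U V assume "U \<in> mt_eta M ` mt_open M" "V \<in> mt_eta M ` mt_open M"
  then obtain u v where uv: "u \<in> mt_open M" "v \<in> mt_open M" "U = mt_eta M u" "V = mt_eta M v"
    by blast
  then have "U \<inter> V = mt_eta M (u \<sqinter> v)"
    using eta_meet[of u v] subsetD[OF open_carrier] by simp
  then show "U \<inter> V \<in> mt_eta M ` mt_open M"
    using open_meet uv by blast
next
  fix \<U> assume "\<forall>U\<in>\<U>. U \<in> mt_eta M ` mt_open M"
  then obtain S where S: "S \<subseteq> mt_open M" "\<U> = mt_eta M ` S"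
    by (meson subset_iff subset_imageE)
  then have "\<Union> \<U> = mt_eta M (\<Squnion> S)"
    using eta_Sup[of S] open_carrier by auto
  then show "\<Union> \<U> \<in> mt_eta M ` mt_open M"
    using open_Sup S by blast
qed

lemma openin_at_obj: "openin (at_obj M) U \<longleftrightarrow> U \<in> mt_eta M ` mt_open M"
  unfolding at_obj_def using istopology_eta by (simp add: topology_inverse')

lemma topspace_at_obj: "topspace (at_obj M) = mt_atoms M"
proof
  obtain u where "u \<in> mt_open M" "topspace (at_obj M) = mt_eta M u"
    using openin_topspace[of "at_obj M"] openin_at_obj by blast
  then show "topspace (at_obj M) \<subseteq> mt_atoms M"
    using eta_apply[of u] subsetD[OF open_carrier] by auto
  have "openin (at_obj M) (mt_atoms M)"
    using open_top eta_top openin_at_obj by blast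
  then show "mt_atoms M \<subseteq> topspace (at_obj M)"
    by (rule openin_subset)
qed

end

text \<open>Separates atomicity from the conditions that produce it: it is all that the isomorphism
  with the powerset of the atoms requires.\<close>

locale atomic_mt_algebra = mt_algebra +
  assumes atomic: "\<lbrakk>b \<in> carrier M; b \<noteq> \<bottom>\<rbrakk> \<Longrightarrow> \<exists>x\<in>mt_atoms M. x \<sqsubseteq> b"
begin

text \<open>Reflecting the order is where atomicity acts: if \<open>a\<close> is not below
  \<open>b\<close>, then \<open>a \<sqinter> \<sim> b\<close> is nonzero, and an atom below it lies
  in the first set but not in the second.\<close>

lemma eta_subset_iff:
  assumes "a \<in> carrier M" "b \<in> carrier M"
  shows "mt_eta M a \<subseteq> mt_eta M b \<longleftrightarrow> a \<sqsubseteq> b"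
proof
  assume sub: "mt_eta M a \<subseteq> mt_eta M b"
  show "a \<sqsubseteq> b"
  proof (rule ccontr)
    assume "\<not> a \<sqsubseteq> b"
    then have "a \<sqinter> \<sim> b \<noteq> \<bottom>"
      using assms le_compl_iff[of a "\<sim> b"] by simp
    then obtain x where x: "x \<in> mt_atoms M" "x \<sqsubseteq> a \<sqinter> \<sim> b"
      using atomic[of "a \<sqinter> \<sim> b"] assms by auto
    then have "x \<in> mt_eta M a" "x \<sqsubseteq> \<sim> b"
      using eta_meet[of a "\<sim> b"] eta_apply[of "a \<sqinter> \<sim> b"] eta_apply[of "\<sim> b"] assms by auto
    then show False
      using sub x assms atom_le_compl_iff by (auto simp: eta_apply)
  qed
next
  assume "a \<sqsubseteq> b"
  then show "mt_eta M a \<subseteq> mt_eta M b"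
    using assms le_trans[of _ a b] subsetD[OF atoms_carrier] by (auto simp: eta_apply)
qed

lemma eta_bij: "bij_betw (mt_eta M) (carrier M) (Pow (mt_atoms M))"
  unfolding bij_betw_def
proof
  show "inj_on (mt_eta M) (carrier M)"
    by (rule inj_onI) (metis eta_subset_iff le_antisym order_refl)
  \<comment> \<open>A set of atoms is the image of its own join, because no further atom lies below
    that join.\<close>
  have "A \<in> mt_eta M ` carrier M" if "A \<subseteq> mt_atoms M" for A
  proof
    have "A \<subseteq> carrier M" using that atoms_carrier by blast
    then show "\<Squnion> A \<in> carrier M" by simp
    have "(\<Union>x\<in>A. mt_eta M x) = (\<Union>x\<in>A. {x})"
      using that eta_atom by (intro SUP_cong) auto
    then show "A = mt_eta M (\<Squnion> A)"
      using eta_Sup[OF \<open>A \<subseteq> carrier M\<close>] by simp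
  qed
  then show "mt_eta M ` carrier M = Pow (mt_atoms M)"
    by (auto simp: eta_apply)
qed

text \<open>Every open subset of \<open>mt_eta M a\<close> has the form \<open>mt_eta M u\<close>
  with \<open>u\<close> open; by order reflection \<open>u\<close> is below \<open>a\<close>, hence
  below \<open>\<box> a\<close>.\<close>

lemma eta_Box:
  assumes "a \<in> carrier M"
  shows "mt_eta M (\<box> a) = at_obj M interior_of mt_eta M a"
proof (rule interior_of_unique[symmetric])
  show "mt_eta M (\<box> a) \<subseteq> mt_eta M a"
    using assms eta_subset_iff Box_closed Box_le by simp
  show "openin (at_obj M) (mt_eta M (\<box> a))"
    using assms Box_open by (simp add: openin_at_obj)
  fix T assume "T \<subseteq> mt_eta M a" "openin (at_obj M) T"
  then obtain u where u: "u \<in> mt_open M" "T = mt_eta M u" "mt_eta M u \<subseteq> mt_eta M a"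
    by (auto simp: openin_at_obj)
  then show "T \<subseteq> mt_eta M (\<box> a)"
    using assms open_le_Box[of u a] Box_closed eta_subset_iff subsetD[OF open_carrier] by simp
qed

end

section \<open>The powerset algebra of a space\<close>

lemma P_obj_simps [simp]:
  "carrier (P_obj X) = Pow (topspace X)" "A \<sqsubseteq>\<^bsub>P_obj X\<^esub> B \<longleftrightarrow> A \<subseteq> B"
  "\<box>\<^bsub>P_obj X\<^esub> A = X interior_of A" "A .=\<^bsub>P_obj X\<^esub> B \<longleftrightarrow> A = B"
  by (simp_all add: P_obj_def)

lemma least_P_obj_Union:
  assumes "S \<subseteq> Pow (topspace X)"
  shows "least (P_obj X) (\<Union>S) (Upper (P_obj X) S)"
proof (rule least_UpperI)
  fix B assume "B \<in> Upper (P_obj X) S"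
  then show "\<Union>S \<sqsubseteq>\<^bsub>P_obj X\<^esub> B"
    using assms by (simp add: Upper_def) blast
qed (use assms in auto)

text \<open>The factor \<open>topspace X\<close> matters for empty \<open>S\<close>, whose
  intersection in HOL is the whole type.\<close>

lemma greatest_P_obj_Inter:
  assumes "S \<subseteq> Pow (topspace X)"
  shows "greatest (P_obj X) (topspace X \<inter> \<Inter>S) (Lower (P_obj X) S)"
proof (rule greatest_LowerI)
  fix B assume "B \<in> Lower (P_obj X) S"
  then show "B \<sqsubseteq>\<^bsub>P_obj X\<^esub> topspace X \<inter> \<Inter>S"
    using assms by (simp add: Lower_def) blast
qed (use assms in auto)

lemma complete_lattice_P_obj: "complete_lattice (P_obj X)"
proof -
  interpret partial_order "P_obj X"
    by unfold_locales (auto simp: P_obj_def)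
  show ?thesis
  proof (rule complete_latticeI)
    fix S assume S: "S \<subseteq> carrier (P_obj X)"
    show "\<exists>s. least (P_obj X) s (Upper (P_obj X) S)"
      using least_P_obj_Union S by auto
    show "\<exists>s. greatest (P_obj X) s (Lower (P_obj X) S)"
      using greatest_P_obj_Inter S by auto
  qed
qed

lemma P_obj_Sup:
  assumes "S \<subseteq> Pow (topspace X)"
  shows "\<Squnion>\<^bsub>P_obj X\<^esub> S = \<Union>S"
proof -
  interpret complete_lattice "P_obj X" by (rule complete_lattice_P_obj)
  show ?thesis
    using least_unique[OF sup_lub[of S] least_P_obj_Union[OF assms]] assms by simp
qed

lemma P_obj_Inf:
  assumes "S \<subseteq> Pow (topspace X)"
  shows "\<Sqinter>\<^bsub>P_obj X\<^esub> S = topspace X \<inter> \<Inter>S"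
proof -
  interpret complete_lattice "P_obj X" by (rule complete_lattice_P_obj)
  show ?thesis
    using greatest_unique[OF inf_glb[of S] greatest_P_obj_Inter[OF assms]] assms by simp
qed

lemma P_obj_join:
  "A \<subseteq> topspace X \<Longrightarrow> B \<subseteq> topspace X \<Longrightarrow> A \<squnion>\<^bsub>P_obj X\<^esub> B = A \<union> B"
  by (simp add: join_def P_obj_Sup)

lemma P_obj_meet:
  "A \<subseteq> topspace X \<Longrightarrow> B \<subseteq> topspace X \<Longrightarrow> A \<sqinter>\<^bsub>P_obj X\<^esub> B = A \<inter> B"
  by (auto simp: meet_def P_obj_Inf)

lemma P_obj_bottom: "\<bottom>\<^bsub>P_obj X\<^esub> = {}"
proof -
  interpret complete_lattice "P_obj X" by (rule complete_lattice_P_obj)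
  show ?thesis using bottom_lower[of "{}"] by simp
qed

lemma P_obj_top: "\<top>\<^bsub>P_obj X\<^esub> = topspace X"
proof -
  interpret complete_lattice "P_obj X" by (rule complete_lattice_P_obj)
  show ?thesis using top_higher[of "topspace X"] top_closed by auto
qed

lemma mt_algebra_P_obj: "mt_algebra (P_obj X)"
proof -
  interpret complete_lattice "P_obj X" by (rule complete_lattice_P_obj)
  show ?thesis
  proof unfold_locales
    fix A B C assume "A \<in> carrier (P_obj X)" "B \<in> carrier (P_obj X)" "C \<in> carrier (P_obj X)"
    then have "A \<subseteq> topspace X" "B \<subseteq> topspace X" "C \<subseteq> topspace X"
      "A \<inter> B \<subseteq> topspace X" "A \<inter> C \<subseteq> topspace X" "B \<union> C \<subseteq> topspace X"
      by auto
    then show "A \<sqinter>\<^bsub>P_obj X\<^esub> (B \<squnion>\<^bsub>P_obj X\<^esub> C) = (A \<sqinter>\<^bsub>P_obj X\<^esub> B) \<squnion>\<^bsub>P_obj X\<^esub> (A \<sqinter>\<^bsub>P_obj X\<^esub> C)"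
      by (simp only: P_obj_meet P_obj_join Int_Un_distrib)
  next
    fix A assume "A \<in> carrier (P_obj X)"
    then show "\<exists>B\<in>carrier (P_obj X). A \<sqinter>\<^bsub>P_obj X\<^esub> B = \<bottom>\<^bsub>P_obj X\<^esub> \<and> A \<squnion>\<^bsub>P_obj X\<^esub> B = \<top>\<^bsub>P_obj X\<^esub>"
      by (intro bexI[of _ "topspace X - A"])
        (auto simp: P_obj_meet P_obj_join P_obj_bottom P_obj_top)
  next
    fix A B assume "A \<in> carrier (P_obj X)" "B \<in> carrier (P_obj X)"
    then show "\<box>\<^bsub>P_obj X\<^esub> (A \<sqinter>\<^bsub>P_obj X\<^esub> B) = \<box>\<^bsub>P_obj X\<^esub> A \<sqinter>\<^bsub>P_obj X\<^esub> \<box>\<^bsub>P_obj X\<^esub> B"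
      by (simp add: P_obj_meet interior_of_subset_topspace interior_of_Int)
  qed (simp_all add: P_obj_top interior_of_subset interior_of_subset_topspace)
qed

section \<open>Topological notions read in the powerset algebra\<close>

lemma P_obj_compl:
  assumes "A \<subseteq> topspace X"
  shows "\<sim>\<^bsub>P_obj X\<^esub> A = topspace X - A"
proof -
  interpret mt_algebra "P_obj X" by (rule mt_algebra_P_obj)
  show ?thesis
    using assms by (intro compl_eqI) (auto simp: P_obj_meet P_obj_join P_obj_bottom P_obj_top)
qed

lemma P_obj_Diamond:
  assumes "A \<subseteq> topspace X"
  shows "\<diamond>\<^bsub>P_obj X\<^esub> A = X closure_of A"
proof -
  have "\<diamond>\<^bsub>P_obj X\<^esub> A = topspace X - (topspace X - X closure_of A)"
    unfolding Diamond_def P_obj_compl[OF assms] P_obj_simps interior_of_complement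
    by (rule P_obj_compl) blast
  then show ?thesis
    using closure_of_subset_topspace[of X A] by (simp add: double_diff)
qed

lemma P_obj_open: "mt_open (P_obj X) = {U. openin X U}"
proof -
  have "U \<subseteq> topspace X \<and> U = X interior_of U \<longleftrightarrow> openin X U" for U
    unfolding eq_commute[of U "X interior_of U"] interior_of_eq using openin_subset by auto
  then show ?thesis
    by (simp add: mt_open_def)
qed

text \<open>Both sides speak of finite subcovers, but \<open>\<Squnion>\<close> is known to be a
  union only for families of subsets of the space. Open families and their subfamilies qualify, so
  the rewriting is done under that assumption.\<close>

lemma P_obj_compact: "mt_compact (P_obj X) K \<longleftrightarrow> compactin X K"
proof -
  have Sup: "\<Squnion>\<^bsub>P_obj X\<^esub> S = \<Union>S" if "S \<subseteq> {U. openin X U}" for S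
    using that openin_subset by (intro P_obj_Sup) auto
  have "(\<exists>T\<subseteq>S. finite T \<and> K \<subseteq> \<Squnion>\<^bsub>P_obj X\<^esub> T) \<longleftrightarrow> (\<exists>T. finite T \<and> T \<subseteq> S \<and> K \<subseteq> \<Union>T)"
    if "S \<subseteq> {U. openin X U}" for S
  proof -
    have "T \<subseteq> S \<and> finite T \<and> K \<subseteq> \<Squnion>\<^bsub>P_obj X\<^esub> T \<longleftrightarrow> finite T \<and> T \<subseteq> S \<and> K \<subseteq> \<Union>T" for T
      using Sup[OF order_trans[OF _ that], of T] by (cases "T \<subseteq> S") simp_all
    then show ?thesis by simp
  qed
  then have *: "(S \<subseteq> {U. openin X U} \<longrightarrow> K \<subseteq> \<Squnion>\<^bsub>P_obj X\<^esub> S \<longrightarrow>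
        (\<exists>T\<subseteq>S. finite T \<and> K \<subseteq> \<Squnion>\<^bsub>P_obj X\<^esub> T)) \<longleftrightarrow>
      ((\<forall>U\<in>S. openin X U) \<and> K \<subseteq> \<Union>S \<longrightarrow> (\<exists>T. finite T \<and> T \<subseteq> S \<and> K \<subseteq> \<Union>T))" for S
    unfolding imp_conjL Ball_Collect by (intro imp_cong refl) (simp_all only: Sup)
  show ?thesis
    unfolding mt_compact_def compactin_def P_obj_open P_obj_simps Pow_iff
    by (rule conj_cong[OF refl], rule iff_allI, rule *)
qed

lemma P_obj_saturated: "mt_saturated (P_obj X) K \<longleftrightarrow> saturatedin X K"
proof -
  have "\<Sqinter>\<^bsub>P_obj X\<^esub> S = topspace X \<inter> \<Inter>S" if "\<forall>U\<in>S. openin X U" for S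
    using that openin_subset by (intro P_obj_Inf) auto
  then have "K = \<Sqinter>\<^bsub>P_obj X\<^esub> S \<longleftrightarrow> K = topspace X \<inter> \<Inter>S" if "\<forall>U\<in>S. openin X U" for S
    using that by simp
  then show ?thesis
    unfolding mt_saturated_def saturatedin_def P_obj_open by (metis (lifting) mem_Collect_eq subset_iff)
qed

lemma P_obj_KS: "mt_KS (P_obj X) = {K. compactin X K \<and> saturatedin X K}"
  by (simp add: mt_KS_def P_obj_compact P_obj_saturated)

lemma P_obj_atoms: "mt_atoms (P_obj X) = (\<lambda>x. {x}) ` topspace X"
proof
  show "mt_atoms (P_obj X) \<subseteq> (\<lambda>x. {x}) ` topspace X"
  proof
    fix A assume A: "A \<in> mt_atoms (P_obj X)"
    then obtain x where x: "x \<in> A" "A \<subseteq> topspace X"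
      by (auto simp: mt_atoms_def P_obj_bottom)
    then have "{x} = A"
      using A by (auto simp: mt_atoms_def P_obj_bottom)
    then show "A \<in> (\<lambda>x. {x}) ` topspace X" using x by auto
  qed
qed (auto simp: mt_atoms_def P_obj_bottom subset_singleton_iff)

lemma P_obj_eta:
  "A \<subseteq> topspace X \<Longrightarrow> mt_eta (P_obj X) A = (\<lambda>x. {x}) ` A"
  by (auto simp: mt_eta_def P_obj_atoms)

lemma LCHMT_P_obj:
  assumes "LCHaus X"
  shows "LCHMT (P_obj X)"
  unfolding LCHMT_def
proof (intro conjI)
  \<comment> \<open>\<open>locally_compact_space\<close> gives each point just one compact
    neighbourhood. In a Hausdorff space there are arbitrarily small ones, as
    \<open>mt_locally_compact\<close> demands.\<close>
  have H: "Hausdorff_space X" and base: "neighbourhood_base_of (compactin X) X"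
    using assms locally_compact_space_neighbourhood_base by (auto simp: LCHaus_def)
  show "mt_algebra (P_obj X)" by (rule mt_algebra_P_obj)
  have AC: "{x} \<in> mt_AC (P_obj X)" if x: "x \<in> topspace X" for x
  proof -
    \<comment> \<open>The closures of the open neighbourhoods of \<open>x\<close>. Singletons are
      the natural candidates for \<open>mt_AC\<close>, as every set is a union of them.\<close>
    define \<D> where "\<D> = {X closure_of (X interior_of C) |C. C \<subseteq> topspace X \<and> x \<in> X interior_of C}"
    have D: "{\<diamond>\<^bsub>P_obj X\<^esub> (\<box>\<^bsub>P_obj X\<^esub> C) |C. C \<in> carrier (P_obj X) \<and> {x} \<sqsubseteq>\<^bsub>P_obj X\<^esub> (\<box>\<^bsub>P_obj X\<^esub> C)} = \<D>"
      unfolding \<D>_def using interior_of_subset_topspace[of X] by (simp add: P_obj_Diamond)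
    \<comment> \<open>For disjoint open \<open>U\<close> and \<open>V\<close> separating
      \<open>x\<close> from \<open>y\<close>, the neighbourhood \<open>V\<close> keeps
      \<open>y\<close> out of the closure of \<open>U\<close>, and \<open>U\<close> is its own
      interior.\<close>
    have "\<exists>d\<in>\<D>. y \<notin> d" if y: "y \<in> topspace X" "y \<noteq> x" for y
    proof -
      obtain U V where UV: "openin X U" "openin X V" "x \<in> U" "y \<in> V" "disjnt U V"
        using H x y unfolding Hausdorff_space_def by metis
      then have "X interior_of U = U" by (simp add: interior_of_eq)
      moreover have "y \<notin> X closure_of U"
        using UV unfolding in_closure_of disjnt_iff by blast
      ultimately show ?thesis
        unfolding \<D>_def using UV openin_subset[OF UV(1)]
        by (intro bexI[of _ "X closure_of U"] CollectI exI[of _ U]) simp_all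
    qed
    moreover have "x \<in> d" if d: "d \<in> \<D>" for d
    proof -
      obtain C where C: "d = X closure_of (X interior_of C)" "x \<in> X interior_of C"
        using d unfolding \<D>_def by auto
      then show ?thesis
        using closure_of_subset[OF interior_of_subset_topspace, of X C] by auto
    qed
    ultimately have "{x} = topspace X \<inter> \<Inter>\<D>"
      using x by (intro equalityI subsetI) auto
    also have "\<dots> = \<Sqinter>\<^bsub>P_obj X\<^esub> \<D>"
      unfolding \<D>_def by (intro P_obj_Inf[symmetric]) (auto dest: subsetD[OF closure_of_subset_topspace])
    finally have "{x} = \<Sqinter>\<^bsub>P_obj X\<^esub> \<D>" .
    moreover have "{x} \<in> carrier (P_obj X)" using x by simp
    ultimately show ?thesis
      unfolding mt_AC_def mem_Collect_eq D by (rule conjI[rotated])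
  qed
  show "mt_Hausdorff (P_obj X)"
    unfolding mt_Hausdorff_def
  proof
    fix B assume "B \<in> carrier (P_obj X)"
    then have B: "(\<lambda>x. {x}) ` B \<subseteq> Pow (topspace X)" by auto
    then have "B = \<Squnion>\<^bsub>P_obj X\<^esub> ((\<lambda>x. {x}) ` B)"
      using P_obj_Sup[OF B] by simp
    moreover have "(\<lambda>x. {x}) ` B \<subseteq> mt_AC (P_obj X)"
      using B AC by auto
    ultimately show "\<exists>S\<subseteq>mt_AC (P_obj X). B = \<Squnion>\<^bsub>P_obj X\<^esub> S"
      by blast
  qed
  show "mt_locally_compact (P_obj X)"
    unfolding mt_locally_compact_def
  proof
    fix U assume "U \<in> mt_open (P_obj X)"
    then have U: "openin X U" by (simp add: P_obj_open)
    let ?S = "{V \<in> mt_open (P_obj X). mt_compactly_below (P_obj X) V U}"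
    have "\<Squnion>\<^bsub>P_obj X\<^esub> ?S = \<Union>?S"
      using openin_subset by (intro P_obj_Sup) (auto simp: P_obj_open)
    also have "\<dots> = U"
    proof
      show "\<Union>?S \<subseteq> U" by (auto simp: mt_compactly_below_def)
      show "U \<subseteq> \<Union>?S"
      proof
        fix x assume "x \<in> U"
        then obtain V K where VK: "openin X V" "compactin X K" "x \<in> V" "V \<subseteq> K" "K \<subseteq> U"
          using base U unfolding neighbourhood_base_of by meson
        then have "mt_compactly_below (P_obj X) V U"
          unfolding mt_compactly_below_def P_obj_compact P_obj_simps by blast
        then have "V \<in> ?S" using VK by (simp add: P_obj_open)
        then show "x \<in> \<Union>?S" using VK by blast
      qed
    qed
    finally show "U = \<Squnion>\<^bsub>P_obj X\<^esub> ?S" ..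
  qed
qed

section \<open>Isomorphisms of MT-algebras\<close>

text \<open>An order isomorphism preserves joins, meets and complements by itself, so only the order
  and \<open>Box\<close> are prescribed. Equality for \<open>Box\<close>, where morphisms have an
  inequality, makes the inverse a morphism too.\<close>

locale mt_isomorphism = M: mt_algebra M + N: mt_algebra N
  for M :: "'a mt" and N :: "'b mt" and f :: "'a \<Rightarrow> 'b" +
  assumes f_ext: "f \<in> extensional (carrier M)"
    and f_bij: "bij_betw f (carrier M) (carrier N)"
    and f_le_iff: "\<lbrakk>a \<in> carrier M; b \<in> carrier M\<rbrakk> \<Longrightarrow> f a \<sqsubseteq>\<^bsub>N\<^esub> f b \<longleftrightarrow> a \<sqsubseteq>\<^bsub>M\<^esub> b"
    and f_Box: "a \<in> carrier M \<Longrightarrow> f (\<box>\<^bsub>M\<^esub> a) = \<box>\<^bsub>N\<^esub> (f a)"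
begin

lemma f_closed [simp]: "a \<in> carrier M \<Longrightarrow> f a \<in> carrier N"
  using f_bij bij_betwE by blast

lemma f_surj:
  assumes "b \<in> carrier N"
  obtains a where "a \<in> carrier M" "b = f a"
  using assms f_bij unfolding bij_betw_def by blast

lemma f_Sup:
  assumes S: "S \<subseteq> carrier M"
  shows "f (\<Squnion>\<^bsub>M\<^esub> S) = \<Squnion>\<^bsub>N\<^esub> (f ` S)"
proof (rule N.le_antisym)
  have fS: "f ` S \<subseteq> carrier N" using S by auto
  then show c: "f (\<Squnion>\<^bsub>M\<^esub> S) \<in> carrier N" "\<Squnion>\<^bsub>N\<^esub> (f ` S) \<in> carrier N"
    using S by auto
  \<comment> \<open>Surjectivity pulls the join of the images back to some \<open>t\<close>; since
    \<open>f\<close> reflects the order, \<open>t\<close> is an upper bound of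
    \<open>S\<close>.\<close>
  obtain t where t: "t \<in> carrier M" "\<Squnion>\<^bsub>N\<^esub> (f ` S) = f t"
    using f_surj c(2) by blast
  have "s \<sqsubseteq>\<^bsub>M\<^esub> t" if "s \<in> S" for s
    using N.sup_upper[OF fS, of "f s"] that S t f_le_iff[of s t] by auto
  then show "f (\<Squnion>\<^bsub>M\<^esub> S) \<sqsubseteq>\<^bsub>N\<^esub> \<Squnion>\<^bsub>N\<^esub> (f ` S)"
    using S t f_le_iff[of "\<Squnion>\<^bsub>M\<^esub> S" t] M.sup_least[OF S, of t] by simp
  have "f s \<sqsubseteq>\<^bsub>N\<^esub> f (\<Squnion>\<^bsub>M\<^esub> S)" if "s \<in> S" for s
    using M.sup_upper[OF S that] f_le_iff[of s "\<Squnion>\<^bsub>M\<^esub> S"] that S by auto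
  then show "\<Squnion>\<^bsub>N\<^esub> (f ` S) \<sqsubseteq>\<^bsub>N\<^esub> f (\<Squnion>\<^bsub>M\<^esub> S)"
    using fS c(1) by (intro N.sup_least) auto
qed

lemma f_Inf:
  assumes S: "S \<subseteq> carrier M"
  shows "f (\<Sqinter>\<^bsub>M\<^esub> S) = \<Sqinter>\<^bsub>N\<^esub> (f ` S)"
proof (rule N.le_antisym)
  have fS: "f ` S \<subseteq> carrier N" using S by auto
  then show c: "f (\<Sqinter>\<^bsub>M\<^esub> S) \<in> carrier N" "\<Sqinter>\<^bsub>N\<^esub> (f ` S) \<in> carrier N"
    using S by auto
  obtain t where t: "t \<in> carrier M" "\<Sqinter>\<^bsub>N\<^esub> (f ` S) = f t"
    using f_surj c(2) by blast
  have "t \<sqsubseteq>\<^bsub>M\<^esub> s" if "s \<in> S" for s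
    using N.inf_lower[OF fS, of "f s"] that S t f_le_iff[of t s] by auto
  then show "\<Sqinter>\<^bsub>N\<^esub> (f ` S) \<sqsubseteq>\<^bsub>N\<^esub> f (\<Sqinter>\<^bsub>M\<^esub> S)"
    using S t f_le_iff[of t "\<Sqinter>\<^bsub>M\<^esub> S"] M.inf_greatest[OF S, of t] by simp
  have "f (\<Sqinter>\<^bsub>M\<^esub> S) \<sqsubseteq>\<^bsub>N\<^esub> f s" if "s \<in> S" for s
    using M.inf_lower[OF S that] f_le_iff[of "\<Sqinter>\<^bsub>M\<^esub> S" s] that S by auto
  then show "f (\<Sqinter>\<^bsub>M\<^esub> S) \<sqsubseteq>\<^bsub>N\<^esub> \<Sqinter>\<^bsub>N\<^esub> (f ` S)"
    using fS c(1) by (intro N.inf_greatest) auto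
qed

lemma f_bottom: "f \<bottom>\<^bsub>M\<^esub> = \<bottom>\<^bsub>N\<^esub>"
  using f_Sup[of "{}"] by (simp add: M.sup_empty N.sup_empty)

lemma f_top: "f \<top>\<^bsub>M\<^esub> = \<top>\<^bsub>N\<^esub>"
proof -
  obtain t where "t \<in> carrier M" "\<top>\<^bsub>N\<^esub> = f t"
    using f_surj[OF N.top_closed] .
  then have "\<top>\<^bsub>N\<^esub> \<sqsubseteq>\<^bsub>N\<^esub> f \<top>\<^bsub>M\<^esub>"
    using f_le_iff[of t "\<top>\<^bsub>M\<^esub>"] by simp
  then show ?thesis
    using N.le_antisym[of "f \<top>\<^bsub>M\<^esub>" "\<top>\<^bsub>N\<^esub>"] by simp
qed

lemma f_compl:
  assumes a: "a \<in> carrier M"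
  shows "f (\<sim>\<^bsub>M\<^esub> a) = \<sim>\<^bsub>N\<^esub> (f a)"
proof (rule N.compl_eqI[symmetric])
  have "f a \<sqinter>\<^bsub>N\<^esub> f (\<sim>\<^bsub>M\<^esub> a) = f (a \<sqinter>\<^bsub>M\<^esub> \<sim>\<^bsub>M\<^esub> a)"
    using f_Inf[of "{a, \<sim>\<^bsub>M\<^esub> a}"] a by (simp add: meet_def)
  then show "f a \<sqinter>\<^bsub>N\<^esub> f (\<sim>\<^bsub>M\<^esub> a) = \<bottom>\<^bsub>N\<^esub>"
    using a by (simp add: M.meet_compl f_bottom)
  have "f a \<squnion>\<^bsub>N\<^esub> f (\<sim>\<^bsub>M\<^esub> a) = f (a \<squnion>\<^bsub>M\<^esub> \<sim>\<^bsub>M\<^esub> a)"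
    using f_Sup[of "{a, \<sim>\<^bsub>M\<^esub> a}"] a by (simp add: join_def)
  then show "f a \<squnion>\<^bsub>N\<^esub> f (\<sim>\<^bsub>M\<^esub> a) = \<top>\<^bsub>N\<^esub>"
    using a by (simp add: M.join_compl f_top)
qed (use a in simp_all)

lemma f_hom: "f \<in> mt_hom M N"
proof -
  have "f (\<box>\<^bsub>M\<^esub> a) \<sqsubseteq>\<^bsub>N\<^esub> \<box>\<^bsub>N\<^esub> (f a)" if "a \<in> carrier M" for a
    using that f_Box by (simp add: N.Box_closed)
  then show ?thesis
    using f_ext by (auto simp: mt_hom_def PiE_iff f_Sup f_Inf f_compl)
qed

lemma f_open: "a \<in> mt_open M \<Longrightarrow> f a \<in> mt_open N"
  using f_Box[of a] by (auto simp: mt_open_def)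

lemma f_open_iff:
  assumes a: "a \<in> carrier M"
  shows "f a \<in> mt_open N \<longleftrightarrow> a \<in> mt_open M"
proof
  assume "f a \<in> mt_open N"
  then have "f a \<sqsubseteq>\<^bsub>N\<^esub> f (\<box>\<^bsub>M\<^esub> a)"
    using f_Box[OF a] a by (simp add: mt_open_def)
  then show "a \<in> mt_open M"
    using a M.openI f_le_iff M.Box_closed by simp
qed (rule f_open)

text \<open>By surjectivity an open cover in \<open>N\<close> is the image of its preimage, which is
  open because \<open>f\<close> reflects openness. A finite subcover found in \<open>M\<close> is
  then mapped forward.\<close>

lemma f_compact:
  assumes "mt_compact M a"
  shows "mt_compact N (f a)"
  unfolding mt_compact_def
proof (intro conjI allI impI)
  have a: "a \<in> carrier M" using assms by (simp add: mt_compact_def)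
  then show "f a \<in> carrier N" by simp
  fix S assume S: "S \<subseteq> mt_open N" "f a \<sqsubseteq>\<^bsub>N\<^esub> \<Squnion>\<^bsub>N\<^esub> S"
  define S' where "S' = {u \<in> carrier M. f u \<in> S}"
  have S'_open: "S' \<subseteq> mt_open M"
    using S f_open_iff by (auto simp: S'_def)
  have S': "S' \<subseteq> carrier M" by (auto simp: S'_def)
  have "S = f ` S'"
  proof
    show "S \<subseteq> f ` S'"
    proof
      fix v assume v: "v \<in> S"
      then have "v \<in> carrier N" using S N.open_carrier by blast
      then obtain u where "u \<in> carrier M" "v = f u" by (rule f_surj)
      then show "v \<in> f ` S'" using v by (simp add: S'_def)
    qed
  qed (auto simp: S'_def)
  then have "f a \<sqsubseteq>\<^bsub>N\<^esub> f (\<Squnion>\<^bsub>M\<^esub> S')"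
    using S f_Sup[OF S'] by simp
  then have "a \<sqsubseteq>\<^bsub>M\<^esub> \<Squnion>\<^bsub>M\<^esub> S'"
    using a S' f_le_iff by simp
  then obtain T where T: "T \<subseteq> S'" "finite T" "a \<sqsubseteq>\<^bsub>M\<^esub> \<Squnion>\<^bsub>M\<^esub> T"
    using assms S'_open unfolding mt_compact_def by blast
  have Tc: "T \<subseteq> carrier M" using T S' by blast
  show "\<exists>T\<subseteq>S. finite T \<and> f a \<sqsubseteq>\<^bsub>N\<^esub> \<Squnion>\<^bsub>N\<^esub> T"
  proof (intro exI conjI)
    show "f ` T \<subseteq> S" using T \<open>S = f ` S'\<close> by blast
    show "finite (f ` T)" using T by simp
    show "f a \<sqsubseteq>\<^bsub>N\<^esub> \<Squnion>\<^bsub>N\<^esub> (f ` T)"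
      using f_Sup[OF Tc] T(3) f_le_iff[of a "\<Squnion>\<^bsub>M\<^esub> T"] a Tc by simp
  qed
qed

lemma f_saturated:
  assumes "mt_saturated M a"
  shows "mt_saturated N (f a)"
proof -
  obtain S where S: "S \<subseteq> mt_open M" "a = \<Sqinter>\<^bsub>M\<^esub> S"
    using assms by (auto simp: mt_saturated_def)
  then have "f a = \<Sqinter>\<^bsub>N\<^esub> (f ` S)"
    using f_Inf[of S] M.open_carrier by auto
  moreover have "f ` S \<subseteq> mt_open N" using S f_open by auto
  ultimately show ?thesis by (auto simp: mt_saturated_def)
qed

lemma f_LCHMT_hom: "f \<in> LCHMT_hom M N"
  using f_hom f_compact f_saturated by (simp add: LCHMT_hom_def mt_KS_def)

text \<open>Lets every transport lemma of this locale be used backwards as well. The restriction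
  keeps the inverse extensional.\<close>

lemma inverse:
  "mt_isomorphism N M (restrict (inv_into (carrier M) f) (carrier N))" (is "mt_isomorphism N M ?g")
proof
  have inj: "inj_on f (carrier M)" and surj: "f ` carrier M = carrier N"
    using f_bij by (auto simp: bij_betw_def)
  have gc: "?g b \<in> carrier M" and fg: "f (?g b) = b" if "b \<in> carrier N" for b
    using that inv_into_into[of b f "carrier M"] f_inv_into_f[of b f "carrier M"] surj by auto
  have gf: "?g (f a) = a" if "a \<in> carrier M" for a
    using that inj by simp
  show "?g \<in> extensional (carrier N)" by simp
  show "bij_betw ?g (carrier N) (carrier M)"
    by (rule bij_betwI[where g = f]) (use gc fg gf in auto)
  fix a assume a: "a \<in> carrier N"
  show "?g a \<sqsubseteq>\<^bsub>M\<^esub> ?g b \<longleftrightarrow> a \<sqsubseteq>\<^bsub>N\<^esub> b" if "b \<in> carrier N" for b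
    using f_le_iff[OF gc[OF a] gc[OF that]] fg[OF a] fg[OF that] by simp
  have "f (\<box>\<^bsub>M\<^esub> ?g a) = \<box>\<^bsub>N\<^esub> a"
    using f_Box[OF gc[OF a]] fg[OF a] by simp
  then show "?g (\<box>\<^bsub>N\<^esub> a) = \<box>\<^bsub>M\<^esub> ?g a"
    using gf[OF M.Box_closed[OF gc[OF a]]] by simp
qed

lemma f_LCHMT_iso: "f \<in> LCHMT_iso M N"
proof -
  let ?g = "restrict (inv_into (carrier M) f) (carrier N)"
  have "?g \<in> LCHMT_hom N M"
    by (rule mt_isomorphism.f_LCHMT_hom[OF inverse])
  moreover have "compose (carrier M) ?g f = (\<lambda>a\<in>carrier M. a)"
    by (rule compose_inv_into_id[OF f_bij])
  moreover have "compose (carrier N) f ?g = (\<lambda>b\<in>carrier N. b)"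
    using f_bij by (intro compose_id_inv_into) (simp add: bij_betw_def)
  ultimately show ?thesis
    using f_LCHMT_hom by (auto simp: LCHMT_iso_def)
qed

end

section \<open>Properties of the space of atoms obtained from the isomorphism
  \<open>mt_eta\<close>\<close>

lemma LCHMT_atomic_mt_algebra:
  assumes "LCHMT M"
  shows "atomic_mt_algebra M"
proof -
  interpret mt_algebra M using assms by (simp add: LCHMT_def)
  show ?thesis
  proof
    fix b assume "b \<in> carrier M" "b \<noteq> \<bottom>\<^bsub>M\<^esub>"
    then show "\<exists>x\<in>mt_atoms M. x \<sqsubseteq>\<^bsub>M\<^esub> b"
      using LCHMT_atomic[of b] assms unfolding LCHMT_def by metis
  qed
qed

context atomic_mt_algebra
begin

lemma eta_isomorphism: "mt_isomorphism M (P_obj (at_obj M)) (mt_eta M)"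
proof -
  interpret P: mt_algebra "P_obj (at_obj M)" by (rule mt_algebra_P_obj)
  show ?thesis
    by unfold_locales
      (use eta_bij eta_subset_iff eta_Box in \<open>simp_all add: topspace_at_obj mt_eta_def[of M]\<close>)
qed

text \<open>One direction transports along \<open>mt_eta M\<close>, the other along its inverse,
  which returns \<open>mt_eta M a\<close> to \<open>a\<close>.\<close>

lemma eta_KS:
  assumes "a \<in> carrier M"
  shows "a \<in> mt_KS M \<longleftrightarrow> compactin (at_obj M) (mt_eta M a) \<and> saturatedin (at_obj M) (mt_eta M a)"
proof -
  interpret I: mt_isomorphism M "P_obj (at_obj M)" "mt_eta M" by (rule eta_isomorphism)
  interpret J: mt_isomorphism "P_obj (at_obj M)" M
      "restrict (inv_into (carrier M) (mt_eta M)) (carrier (P_obj (at_obj M)))"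
    by (rule I.inverse)
  have inv: "restrict (inv_into (carrier M) (mt_eta M)) (carrier (P_obj (at_obj M))) (mt_eta M a) = a"
    using I.f_closed[OF assms] I.f_bij assms by (simp add: bij_betw_def)
  have "a \<in> mt_KS M \<longleftrightarrow> mt_eta M a \<in> mt_KS (P_obj (at_obj M))"
    using I.f_compact I.f_saturated J.f_compact[of "mt_eta M a"] J.f_saturated[of "mt_eta M a"]
    unfolding inv by (auto simp: mt_KS_def)
  then show ?thesis by (simp add: P_obj_KS)
qed

end

lemma LCHaus_at_obj:
  assumes "LCHMT M"
  shows "LCHaus (at_obj M)"
proof -
  interpret atomic_mt_algebra M by (rule LCHMT_atomic_mt_algebra[OF assms])
  interpret I: mt_isomorphism M "P_obj (at_obj M)" "mt_eta M" by (rule eta_isomorphism)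
  have H: "mt_Hausdorff M" and LC: "mt_locally_compact M"
    using assms by (auto simp: LCHMT_def)
  have "\<exists>U V. openin (at_obj M) U \<and> openin (at_obj M) V \<and> x \<in> U \<and> y \<in> V \<and> disjnt U V"
    if x: "x \<in> mt_atoms M" and y: "y \<in> mt_atoms M" and "x \<noteq> y" for x y
  proof -
    have xc: "x \<in> carrier M" "x \<noteq> \<bottom>\<^bsub>M\<^esub>" and yc: "y \<in> carrier M"
      using x y by (auto simp: mt_atoms_def)
    define D where "D = {\<diamond>\<^bsub>M\<^esub> (\<box>\<^bsub>M\<^esub> c) |c. c \<in> carrier M \<and> x \<sqsubseteq>\<^bsub>M\<^esub> (\<box>\<^bsub>M\<^esub> c)}"
    have Dc: "D \<subseteq> carrier M"
      using Diamond_closed closed_carrier Box_closed by (auto simp: D_def)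
    obtain a where a: "a \<in> mt_AC M" "a \<noteq> \<bottom>\<^bsub>M\<^esub>" "a \<sqsubseteq>\<^bsub>M\<^esub> x"
      using Hausdorff_AC_below[OF H xc] by blast
    \<comment> \<open>A nonzero element below an atom is that atom, so \<open>x\<close> itself
      belongs to \<open>mt_AC M\<close> and equals the meet of \<open>D\<close>.\<close>
    then have "a = x"
      using x by (auto simp: mt_atoms_def mt_AC_def)
    then have "x = \<Sqinter>\<^bsub>M\<^esub> D"
      using a by (simp add: mt_AC_def D_def)
    moreover have "\<not> y \<sqsubseteq>\<^bsub>M\<^esub> x"
      using atom_eq_if_le[OF y x] \<open>x \<noteq> y\<close> by blast
    ultimately obtain d where "d \<in> D" "\<not> y \<sqsubseteq>\<^bsub>M\<^esub> d"
      using le_Inf_iff[OF yc Dc] by auto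
    then obtain c where c: "c \<in> carrier M" "x \<sqsubseteq>\<^bsub>M\<^esub> \<box>\<^bsub>M\<^esub> c" "\<not> y \<sqsubseteq>\<^bsub>M\<^esub> \<diamond>\<^bsub>M\<^esub> (\<box>\<^bsub>M\<^esub> c)"
      by (auto simp: D_def)
    \<comment> \<open>The separating neighbourhoods: \<open>u\<close> contains \<open>x\<close>, and
      \<open>v\<close> is the complement of the closure of \<open>u\<close>. As \<open>y\<close> is
      an atom not below that closure, it lies below \<open>v\<close>.\<close>
    define u where "u = \<box>\<^bsub>M\<^esub> c"
    define v where "v = \<box>\<^bsub>M\<^esub> (\<sim>\<^bsub>M\<^esub> u)"
    have u: "u \<in> mt_open M" "u \<in> carrier M" and v: "v \<in> mt_open M" "v \<in> carrier M"
      using c Box_open Box_closed by (simp_all add: u_def v_def)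
    have "y \<sqsubseteq>\<^bsub>M\<^esub> v"
      using c(3) atom_le_compl_iff[OF y v(2)] by (simp add: Diamond_def v_def u_def)
    have "\<not> (z \<sqsubseteq>\<^bsub>M\<^esub> u \<and> z \<sqsubseteq>\<^bsub>M\<^esub> v)" if z: "z \<in> mt_atoms M" for z
    proof
      assume *: "z \<sqsubseteq>\<^bsub>M\<^esub> u \<and> z \<sqsubseteq>\<^bsub>M\<^esub> v"
      have "z \<in> carrier M" using z atoms_carrier by blast
      then have "z \<sqsubseteq>\<^bsub>M\<^esub> \<sim>\<^bsub>M\<^esub> u"
        using * le_trans[of z v "\<sim>\<^bsub>M\<^esub> u"] Box_le[of "\<sim>\<^bsub>M\<^esub> u"] u v by (simp add: v_def)
      then show False using atom_le_compl_iff[OF z u(2)] * by blast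
    qed
    then have "disjnt (mt_eta M u) (mt_eta M v)"
      using u v by (auto simp: disjnt_iff eta_apply)
    moreover have "x \<in> mt_eta M u" "y \<in> mt_eta M v"
      using c x y \<open>y \<sqsubseteq>\<^bsub>M\<^esub> v\<close> u v by (auto simp: eta_apply u_def)
    ultimately show ?thesis
      using u v openin_at_obj by blast
  qed
  then have "Hausdorff_space (at_obj M)"
    unfolding Hausdorff_space_def topspace_at_obj by blast
  moreover have "locally_compact_space (at_obj M)"
    unfolding locally_compact_space_def topspace_at_obj
  proof
    fix x assume x: "x \<in> mt_atoms M"
    then have xc: "x \<in> carrier M" using atoms_carrier by blast
    let ?V = "{v \<in> mt_open M. mt_compactly_below M v \<top>\<^bsub>M\<^esub>}"
    have V: "?V \<subseteq> carrier M" using open_carrier by auto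
    have "\<top>\<^bsub>M\<^esub> = \<Squnion>\<^bsub>M\<^esub> ?V"
      using LC open_top unfolding mt_locally_compact_def by blast
    then have "x \<sqsubseteq>\<^bsub>M\<^esub> \<Squnion>\<^bsub>M\<^esub> ?V" using top_higher[OF xc] by simp
    then obtain v where v: "v \<in> ?V" "x \<sqsubseteq>\<^bsub>M\<^esub> v"
      using atom_le_Sup_iff[OF x V] by blast
    then obtain k where k: "mt_compact M k" "v \<sqsubseteq>\<^bsub>M\<^esub> k"
      by (auto simp: mt_compactly_below_def)
    have vc: "v \<in> carrier M" and kc: "k \<in> carrier M"
      using v V k by (auto simp: mt_compact_def)
    have "openin (at_obj M) (mt_eta M v)"
      using v by (simp add: openin_at_obj)
    moreover have "compactin (at_obj M) (mt_eta M k)"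
      using I.f_compact[OF k(1)] by (simp add: P_obj_compact)
    moreover have "x \<in> mt_eta M v" "mt_eta M v \<subseteq> mt_eta M k"
      using x v k vc kc eta_subset_iff by (auto simp: eta_apply)
    ultimately show "\<exists>U K. openin (at_obj M) U \<and> compactin (at_obj M) K \<and> x \<in> U \<and> U \<subseteq> K"
      by blast
  qed
  ultimately show ?thesis by (simp add: LCHaus_def)
qed

section \<open>Morphisms of MT-algebras and their maps of atoms\<close>

locale mt_morphism = M: mt_algebra M + N: mt_algebra N
  for M :: "'a mt" and N :: "'b mt" and f :: "'a \<Rightarrow> 'b" +
  assumes f_hom: "f \<in> mt_hom M N"
begin

lemma f_closed [simp]: "a \<in> carrier M \<Longrightarrow> f a \<in> carrier N"
  using f_hom by (auto simp: mt_hom_def)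

lemma f_Sup: "S \<subseteq> carrier M \<Longrightarrow> f (\<Squnion>\<^bsub>M\<^esub> S) = \<Squnion>\<^bsub>N\<^esub> (f ` S)"
  using f_hom by (simp add: mt_hom_def)

lemma f_Inf: "S \<subseteq> carrier M \<Longrightarrow> f (\<Sqinter>\<^bsub>M\<^esub> S) = \<Sqinter>\<^bsub>N\<^esub> (f ` S)"
  using f_hom by (simp add: mt_hom_def)

lemma f_compl: "a \<in> carrier M \<Longrightarrow> f (\<sim>\<^bsub>M\<^esub> a) = \<sim>\<^bsub>N\<^esub> (f a)"
  using f_hom by (simp add: mt_hom_def)

lemma f_bottom: "f \<bottom>\<^bsub>M\<^esub> = \<bottom>\<^bsub>N\<^esub>"
  using f_Sup[of "{}"] by (simp add: M.sup_empty N.sup_empty)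

lemma f_mono:
  assumes "a \<in> carrier M" "b \<in> carrier M" "a \<sqsubseteq>\<^bsub>M\<^esub> b"
  shows "f a \<sqsubseteq>\<^bsub>N\<^esub> f b"
proof -
  have "f (a \<squnion>\<^bsub>M\<^esub> b) = f a \<squnion>\<^bsub>N\<^esub> f b"
    using f_Sup[of "{a, b}"] assms by (simp add: join_def)
  then show ?thesis
    using assms M.le_iff_meet[of a b] N.le_iff_meet[of "f a" "f b"] by simp
qed

lemma f_open:
  assumes "a \<in> mt_open M"
  shows "f a \<in> mt_open N"
proof (rule N.openI)
  have a: "a \<in> carrier M" "a = \<box>\<^bsub>M\<^esub> a" using assms by (simp_all add: mt_open_def)
  have "f (\<box>\<^bsub>M\<^esub> a) \<sqsubseteq>\<^bsub>N\<^esub> \<box>\<^bsub>N\<^esub> (f a)"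
    using f_hom a(1) by (simp add: mt_hom_def)
  then show "f a \<sqsubseteq>\<^bsub>N\<^esub> \<box>\<^bsub>N\<^esub> (f a)"
    using a(2) by simp
qed (use assms in \<open>simp add: mt_open_def\<close>)

lemma at_map_closed: "x \<in> mt_atoms N \<Longrightarrow> at_map M N f x \<in> carrier M"
  by (auto simp: at_map_def intro!: M.inf_closed)

lemma at_map_le_iff:
  assumes x: "x \<in> mt_atoms N" and a: "a \<in> carrier M"
  shows "at_map M N f x \<sqsubseteq>\<^bsub>M\<^esub> a \<longleftrightarrow> x \<sqsubseteq>\<^bsub>N\<^esub> f a"
proof
  let ?A = "{a \<in> carrier M. x \<sqsubseteq>\<^bsub>N\<^esub> f a}"
  have xc: "x \<in> carrier N" using x N.atoms_carrier by blast
  have A: "?A \<subseteq> carrier M" "f ` ?A \<subseteq> carrier N" by auto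
  have eq: "at_map M N f x = \<Sqinter>\<^bsub>M\<^esub> ?A" using x by (simp add: at_map_def)
  \<comment> \<open>The unit of the adjunction; it holds because \<open>f\<close> preserves
    arbitrary meets.\<close>
  have "x \<sqsubseteq>\<^bsub>N\<^esub> \<Sqinter>\<^bsub>N\<^esub> (f ` ?A)"
    using N.le_Inf_iff[OF xc A(2)] by blast
  then have *: "x \<sqsubseteq>\<^bsub>N\<^esub> f (at_map M N f x)"
    using f_Inf[OF A(1)] eq by simp
  show "x \<sqsubseteq>\<^bsub>N\<^esub> f a" if "at_map M N f x \<sqsubseteq>\<^bsub>M\<^esub> a"
    using N.le_trans[OF * f_mono[OF at_map_closed[OF x] a that]] xc at_map_closed[OF x] a by simp
  show "at_map M N f x \<sqsubseteq>\<^bsub>M\<^esub> a" if "x \<sqsubseteq>\<^bsub>N\<^esub> f a"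
    unfolding eq using A(1) a that by (intro M.inf_lower) auto
qed

text \<open>For \<open>y\<close> below the image \<open>?z\<close>, the atom \<open>x\<close> lies
  below \<open>f y\<close> or below its complement, which is \<open>f (\<sim> y)\<close>. By
  adjunction \<open>?z\<close> lies below \<open>y\<close> or below \<open>\<sim> y\<close>; in the
  second case \<open>y\<close> lies below its own complement and vanishes.\<close>

lemma at_map_atom:
  assumes x: "x \<in> mt_atoms N"
  shows "at_map M N f x \<in> mt_atoms M"
proof -
  let ?z = "at_map M N f x"
  have xc: "x \<in> carrier N" "x \<noteq> \<bottom>\<^bsub>N\<^esub>" using x by (auto simp: mt_atoms_def)
  have zc: "?z \<in> carrier M" by (rule at_map_closed[OF x])
  have "?z \<noteq> \<bottom>\<^bsub>M\<^esub>"
  proof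
    assume "?z = \<bottom>\<^bsub>M\<^esub>"
    then have "x \<sqsubseteq>\<^bsub>N\<^esub> \<bottom>\<^bsub>N\<^esub>"
      using at_map_le_iff[OF x M.bottom_closed] f_bottom by simp
    then show False using xc N.eq_bottom by blast
  qed
  moreover have "y = \<bottom>\<^bsub>M\<^esub> \<or> y = ?z" if y: "y \<in> carrier M" "y \<sqsubseteq>\<^bsub>M\<^esub> ?z" for y
  proof (cases "x \<sqsubseteq>\<^bsub>N\<^esub> f y")
    case True
    then have "?z \<sqsubseteq>\<^bsub>M\<^esub> y" using at_map_le_iff[OF x y(1)] by simp
    then show ?thesis using M.le_antisym[OF y(2) _ y(1) zc] by simp
  next
    case False
    then have "x \<sqsubseteq>\<^bsub>N\<^esub> f (\<sim>\<^bsub>M\<^esub> y)"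
      using N.atom_le_compl_iff[OF x, of "f y"] y f_compl by simp
    then have "?z \<sqsubseteq>\<^bsub>M\<^esub> \<sim>\<^bsub>M\<^esub> y" using at_map_le_iff[OF x] y by simp
    then have "y \<sqsubseteq>\<^bsub>M\<^esub> \<sim>\<^bsub>M\<^esub> y"
      using M.le_trans[OF y(2)] y zc by simp
    then show ?thesis using M.le_compl_self y by blast
  qed
  ultimately show ?thesis using zc by (auto simp: mt_atoms_def)
qed

lemma at_map_preimage:
  assumes "a \<in> carrier M"
  shows "{x \<in> mt_atoms N. at_map M N f x \<in> mt_eta M a} = mt_eta N (f a)"
  using assms at_map_atom at_map_le_iff
  by (simp add: M.eta_apply N.eta_apply cong: conj_cong)

lemma at_map_PiE: "at_map M N f \<in> topspace (at_obj N) \<rightarrow>\<^sub>E topspace (at_obj M)"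
  using at_map_atom by (auto simp: M.topspace_at_obj N.topspace_at_obj at_map_def)

lemma at_map_continuous: "continuous_map (at_obj N) (at_obj M) (at_map M N f)"
  unfolding continuous_map
proof (intro conjI allI impI)
  show "at_map M N f ` topspace (at_obj N) \<subseteq> topspace (at_obj M)"
    using at_map_PiE by blast
  fix U assume "openin (at_obj M) U"
  then obtain u where u: "u \<in> mt_open M" "U = mt_eta M u"
    by (auto simp: M.openin_at_obj)
  then have "{x \<in> topspace (at_obj N). at_map M N f x \<in> U} = mt_eta N (f u)"
    using at_map_preimage[of u] M.open_carrier N.topspace_at_obj by auto
  then show "openin (at_obj N) {x \<in> topspace (at_obj N). at_map M N f x \<in> U}"
    using f_open[OF u(1)] by (simp add: N.openin_at_obj)
qed

lemma eta_natural:
  "compose (carrier M) (P_map (at_obj N) (at_obj M) (at_map M N f)) (mt_eta M)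
     = compose (carrier M) (mt_eta N) f"
proof
  fix a
  show "compose (carrier M) (P_map (at_obj N) (at_obj M) (at_map M N f)) (mt_eta M) a
     = compose (carrier M) (mt_eta N) f a"
  proof (cases "a \<in> carrier M")
    case True
    then have "mt_eta M a \<subseteq> mt_atoms M" by (auto simp: M.eta_apply)
    then show ?thesis
      using True at_map_preimage[OF True]
      by (simp add: compose_def P_map_def M.topspace_at_obj N.topspace_at_obj)
  qed (simp add: compose_def)
qed

end

lemma at_map_LCHaus_hom:
  assumes "LCHMT M" "LCHMT N" and f: "f \<in> LCHMT_hom M N"
  shows "at_map M N f \<in> LCHaus_hom (at_obj N) (at_obj M)"
proof -
  interpret M: atomic_mt_algebra M by (rule LCHMT_atomic_mt_algebra) fact
  interpret N: atomic_mt_algebra N by (rule LCHMT_atomic_mt_algebra) fact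
  interpret mt_morphism M N f
    using f by unfold_locales (simp add: LCHMT_hom_def)
  have "compactin (at_obj N) {x \<in> topspace (at_obj N). at_map M N f x \<in> K}"
    if K: "compactin (at_obj M) K \<and> saturatedin (at_obj M) K" for K
  proof -
    have "K \<subseteq> mt_atoms M"
      using K compactin_subset_topspace M.topspace_at_obj by metis
    \<comment> \<open>Surjectivity of \<open>mt_eta M\<close> turns the set \<open>K\<close> into an
      element, to which the properness of \<open>f\<close> can be applied.\<close>
    then obtain a where a: "a \<in> carrier M" "K = mt_eta M a"
      using M.eta_bij unfolding bij_betw_def by blast
    then have "f a \<in> mt_KS N"
      using K M.eta_KS f by (simp add: LCHMT_hom_def)
    then show ?thesis
      using N.eta_KS[of "f a"] at_map_preimage[OF a(1)] a N.topspace_at_obj by simp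
  qed
  then show ?thesis
    using at_map_PiE at_map_continuous by (simp add: LCHaus_hom_def)
qed

section \<open>Category laws, functoriality and naturality on the algebraic side\<close>

lemma LCHMT_hom_id:
  assumes "LCHMT M"
  shows "(\<lambda>a\<in>carrier M. a) \<in> LCHMT_hom M M"
proof -
  interpret mt_algebra M using assms by (simp add: LCHMT_def)
  interpret mt_isomorphism M M "\<lambda>a\<in>carrier M. a"
    by unfold_locales (auto simp: bij_betw_def inj_on_def Box_closed)
  show ?thesis by (rule f_LCHMT_hom)
qed

lemma LCHMT_hom_compose:
  assumes "LCHMT M" "LCHMT N" "LCHMT L" and f: "f \<in> LCHMT_hom M N" and g: "g \<in> LCHMT_hom N L"
  shows "compose (carrier M) g f \<in> LCHMT_hom M L"
proof -
  interpret M: mt_algebra M using assms by (simp add: LCHMT_def)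
  interpret N: mt_algebra N using assms by (simp add: LCHMT_def)
  interpret L: mt_algebra L using assms by (simp add: LCHMT_def)
  interpret f: mt_morphism M N f using f by unfold_locales (simp add: LCHMT_hom_def)
  interpret g: mt_morphism N L g using g by unfold_locales (simp add: LCHMT_hom_def)
  have img: "compose (carrier M) g f ` S = g ` f ` S" "f ` S \<subseteq> carrier N" if "S \<subseteq> carrier M" for S
    using that by (auto simp: compose_def image_image intro!: image_cong)
  have "compose (carrier M) g f \<in> carrier M \<rightarrow>\<^sub>E carrier L"
    by (auto simp: compose_def)
  moreover have "compose (carrier M) g f (\<Squnion>\<^bsub>M\<^esub> S) = \<Squnion>\<^bsub>L\<^esub> (compose (carrier M) g f ` S)"
    if S: "S \<subseteq> carrier M" for S
    using S by (simp only: img[OF S]) (simp add: compose_eq f.f_Sup g.f_Sup img)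
  moreover have "compose (carrier M) g f (\<Sqinter>\<^bsub>M\<^esub> S) = \<Sqinter>\<^bsub>L\<^esub> (compose (carrier M) g f ` S)"
    if S: "S \<subseteq> carrier M" for S
    using S by (simp only: img[OF S]) (simp add: compose_eq f.f_Inf g.f_Inf img)
  moreover have "compose (carrier M) g f (\<sim>\<^bsub>M\<^esub> a) = \<sim>\<^bsub>L\<^esub> (compose (carrier M) g f a)"
    if a: "a \<in> carrier M" for a
    using a by (simp add: compose_eq f.f_compl g.f_compl)
  moreover have "compose (carrier M) g f (\<box>\<^bsub>M\<^esub> a) \<sqsubseteq>\<^bsub>L\<^esub> \<box>\<^bsub>L\<^esub> (compose (carrier M) g f a)"
    if a: "a \<in> carrier M" for a
  proof -
    have "f (\<box>\<^bsub>M\<^esub> a) \<sqsubseteq>\<^bsub>N\<^esub> \<box>\<^bsub>N\<^esub> (f a)" "g (\<box>\<^bsub>N\<^esub> (f a)) \<sqsubseteq>\<^bsub>L\<^esub> \<box>\<^bsub>L\<^esub> (g (f a))"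
      using f.f_hom g.f_hom a by (simp_all add: mt_hom_def)
    \<comment> \<open>The inequality for \<open>f\<close> must first be pushed through
      \<open>g\<close>, which is monotone because it preserves binary joins.\<close>
    then have "g (f (\<box>\<^bsub>M\<^esub> a)) \<sqsubseteq>\<^bsub>L\<^esub> \<box>\<^bsub>L\<^esub> (g (f a))"
      using g.f_mono[of "f (\<box>\<^bsub>M\<^esub> a)" "\<box>\<^bsub>N\<^esub> (f a)"] a
        L.le_trans[of "g (f (\<box>\<^bsub>M\<^esub> a))" "g (\<box>\<^bsub>N\<^esub> (f a))" "\<box>\<^bsub>L\<^esub> (g (f a))"]
      by (simp add: M.Box_closed N.Box_closed L.Box_closed)
    then show ?thesis using a by (simp add: compose_eq M.Box_closed)
  qed
  moreover have "compose (carrier M) g f a \<in> mt_KS L" if a: "a \<in> mt_KS M" for a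
  proof -
    have "a \<in> carrier M" using a by (simp add: mt_KS_def mt_compact_def)
    then show ?thesis using a f g by (simp add: compose_eq LCHMT_hom_def)
  qed
  ultimately show ?thesis
    by (simp add: LCHMT_hom_def mt_hom_def)
qed

lemma eta_LCHMT_iso:
  assumes "LCHMT M"
  shows "mt_eta M \<in> LCHMT_iso M (P_obj (at_obj M))"
  by (rule mt_isomorphism.f_LCHMT_iso[OF atomic_mt_algebra.eta_isomorphism])
    (rule LCHMT_atomic_mt_algebra[OF assms])

lemma eta_natural:
  assumes "LCHMT M" "LCHMT N" "f \<in> LCHMT_hom M N"
  shows "compose (carrier M) (P_map (at_obj N) (at_obj M) (at_map M N f)) (mt_eta M)
    = compose (carrier M) (mt_eta N) f"
proof -
  interpret M: mt_algebra M using assms by (simp add: LCHMT_def)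
  interpret N: mt_algebra N using assms by (simp add: LCHMT_def)
  interpret mt_morphism M N f using assms by unfold_locales (simp add: LCHMT_hom_def)
  show ?thesis by (rule eta_natural)
qed

text \<open>By adjunction the image of an atom lies below that atom, and comparable atoms are
  equal.\<close>

lemma at_map_id:
  assumes "LCHMT M"
  shows "at_map M M (\<lambda>a\<in>carrier M. a) = (\<lambda>x\<in>topspace (at_obj M). x)"
proof
  interpret mt_algebra M using assms by (simp add: LCHMT_def)
  interpret mt_morphism M M "\<lambda>a\<in>carrier M. a"
    using LCHMT_hom_id[OF assms] by unfold_locales (simp add: LCHMT_hom_def)
  fix x
  show "at_map M M (\<lambda>a\<in>carrier M. a) x = (\<lambda>x\<in>topspace (at_obj M). x) x"
  proof (cases "x \<in> mt_atoms M")
    case True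
    then have "x \<in> carrier M" using atoms_carrier by blast
    then have "at_map M M (\<lambda>a\<in>carrier M. a) x = x"
      using at_map_le_iff[OF True, of x] atom_eq_if_le[OF at_map_atom[OF True] True] by simp
    then show ?thesis using True by (simp add: topspace_at_obj)
  qed (simp add: at_map_def topspace_at_obj)
qed

text \<open>Left adjoints compose in reverse order. Both sides are atoms, so one inequality
  suffices: \<open>x\<close> lies below \<open>g (f ?y)\<close> by applying the two adjunctions in
  turn.\<close>

lemma at_map_compose:
  assumes "LCHMT M" "LCHMT N" "LCHMT L" and f: "f \<in> LCHMT_hom M N" and g: "g \<in> LCHMT_hom N L"
  shows "at_map M L (compose (carrier M) g f)
    = compose (topspace (at_obj L)) (at_map M N f) (at_map N L g)"
proof
  interpret M: mt_algebra M using assms by (simp add: LCHMT_def)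
  interpret N: mt_algebra N using assms by (simp add: LCHMT_def)
  interpret L: mt_algebra L using assms by (simp add: LCHMT_def)
  interpret f: mt_morphism M N f using f by unfold_locales (simp add: LCHMT_hom_def)
  interpret g: mt_morphism N L g using g by unfold_locales (simp add: LCHMT_hom_def)
  interpret gf: mt_morphism M L "compose (carrier M) g f"
    using LCHMT_hom_compose[OF assms] by unfold_locales (simp add: LCHMT_hom_def)
  fix x
  show "at_map M L (compose (carrier M) g f) x
    = compose (topspace (at_obj L)) (at_map M N f) (at_map N L g) x"
  proof (cases "x \<in> mt_atoms L")
    case True
    let ?y = "at_map M N f (at_map N L g x)"
    have y: "?y \<in> mt_atoms M" and z: "at_map M L (compose (carrier M) g f) x \<in> mt_atoms M"
      using True f.at_map_atom g.at_map_atom gf.at_map_atom by blast+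
    have yc: "?y \<in> carrier M" using y M.atoms_carrier by blast
    have "at_map N L g x \<sqsubseteq>\<^bsub>N\<^esub> f ?y"
      using f.at_map_le_iff[OF g.at_map_atom[OF True] yc] yc by simp
    then have "at_map M L (compose (carrier M) g f) x \<sqsubseteq>\<^bsub>M\<^esub> ?y"
      using gf.at_map_le_iff[OF True yc] g.at_map_le_iff[OF True, of "f ?y"] yc
      by (simp add: compose_eq)
    then show ?thesis
      using M.atom_eq_if_le[OF z y] True by (simp add: compose_eq L.topspace_at_obj)
  qed (simp add: at_map_def compose_def L.topspace_at_obj)
qed

section \<open>Continuous maps\<close>

lemma LCHaus_hom_id: "(\<lambda>x\<in>topspace X. x) \<in> LCHaus_hom X X"
proof -
  have "{x \<in> topspace X. (\<lambda>x\<in>topspace X. x) x \<in> K} = K" if "compactin X K" for K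
    using compactin_subset_topspace[OF that] by auto
  moreover have "continuous_map X X (\<lambda>x\<in>topspace X. x)"
    by (rule continuous_map_eq[OF continuous_map_id]) simp
  ultimately show ?thesis
    by (simp add: LCHaus_hom_def)
qed

lemma LCHaus_hom_continuous: "f \<in> LCHaus_hom X Y \<Longrightarrow> continuous_map X Y f"
  by (simp add: LCHaus_hom_def)

lemma LCHaus_hom_closed: "f \<in> LCHaus_hom X Y \<Longrightarrow> x \<in> topspace X \<Longrightarrow> f x \<in> topspace Y"
  by (auto simp: LCHaus_hom_def)

text \<open>Properness yields only compactness of a preimage; saturation from continuity is needed
  before a second proper map can be applied, and for membership in \<open>mt_KS\<close>.\<close>

lemma saturatedin_preimage:
  assumes f: "continuous_map X Y f" and K: "saturatedin Y K"
  shows "saturatedin X {x \<in> topspace X. f x \<in> K}"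
proof -
  obtain \<U> where U: "\<forall>U\<in>\<U>. openin Y U" "K = topspace Y \<inter> \<Inter>\<U>"
    using K by (auto simp: saturatedin_def)
  have "\<forall>V\<in>(\<lambda>U. {x \<in> topspace X. f x \<in> U}) ` \<U>. openin X V"
    using U(1) openin_continuous_map_preimage[OF f] by auto
  moreover have "f x \<in> topspace Y" if "x \<in> topspace X" for x
    using continuous_map_image_subset_topspace[OF f] that by blast
  then have "{x \<in> topspace X. f x \<in> K} = topspace X \<inter> \<Inter>((\<lambda>U. {x \<in> topspace X. f x \<in> U}) ` \<U>)"
    unfolding U(2) by auto
  ultimately show ?thesis
    unfolding saturatedin_def by blast
qed

lemma LCHaus_hom_compose:
  assumes f: "f \<in> LCHaus_hom X Y" and g: "g \<in> LCHaus_hom Y Z"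
  shows "compose (topspace X) g f \<in> LCHaus_hom X Z"
proof -
  note cf = LCHaus_hom_continuous[OF f] and cg = LCHaus_hom_continuous[OF g]
  have "compose (topspace X) g f \<in> topspace X \<rightarrow>\<^sub>E topspace Z"
    using LCHaus_hom_closed[OF f] LCHaus_hom_closed[OF g] by (auto simp: compose_def)
  moreover have "continuous_map X Z (compose (topspace X) g f)"
    by (rule continuous_map_eq[OF continuous_map_compose[OF cf cg]]) (simp add: compose_eq)
  moreover have "compactin X {x \<in> topspace X. compose (topspace X) g f x \<in> K}"
    if K: "compactin Z K" "saturatedin Z K" for K
  proof -
    let ?K' = "{y \<in> topspace Y. g y \<in> K}"
    have "compactin Y ?K'" "saturatedin Y ?K'"
      using g K saturatedin_preimage[OF cg] by (auto simp: LCHaus_hom_def)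
    then have "compactin X {x \<in> topspace X. f x \<in> ?K'}"
      using f unfolding LCHaus_hom_def by blast
    moreover have "{x \<in> topspace X. f x \<in> ?K'} = {x \<in> topspace X. compose (topspace X) g f x \<in> K}"
      using LCHaus_hom_closed[OF f] by (auto simp: compose_eq)
    ultimately show ?thesis by simp
  qed
  ultimately show ?thesis
    by (simp add: LCHaus_hom_def)
qed

section \<open>Preimage maps as proper morphisms of powerset algebras\<close>

lemma P_map_LCHMT_hom:
  assumes f: "f \<in> LCHaus_hom X Y"
  shows "P_map X Y f \<in> LCHMT_hom (P_obj Y) (P_obj X)"
proof -
  note cf = LCHaus_hom_continuous[OF f]
  have fc: "f x \<in> topspace Y" if "x \<in> topspace X" for x
    using LCHaus_hom_closed[OF f that] .
  have Pm: "P_map X Y f B = {x \<in> topspace X. f x \<in> B}" if "B \<subseteq> topspace Y" for B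
    using that by (simp add: P_map_def)
  have img: "P_map X Y f ` S = (\<lambda>B. {x \<in> topspace X. f x \<in> B}) ` S"
    "P_map X Y f ` S \<subseteq> Pow (topspace X)" if "S \<subseteq> Pow (topspace Y)" for S
    using that Pm by (auto intro!: image_cong)
  have "P_map X Y f \<in> carrier (P_obj Y) \<rightarrow>\<^sub>E carrier (P_obj X)"
    by (auto simp: P_map_def)
  moreover have "P_map X Y f (\<Squnion>\<^bsub>P_obj Y\<^esub> S) = \<Squnion>\<^bsub>P_obj X\<^esub> (P_map X Y f ` S)"
    if S: "S \<subseteq> carrier (P_obj Y)" for S
  proof -
    have S': "S \<subseteq> Pow (topspace Y)" "\<Union>S \<subseteq> topspace Y" using S by auto
    show ?thesis
      unfolding P_obj_Sup[OF S'(1)] P_obj_Sup[OF img(2)[OF S'(1)]] Pm[OF S'(2)]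
      unfolding img(1)[OF S'(1)]
      by auto
  qed
  moreover have "P_map X Y f (\<Sqinter>\<^bsub>P_obj Y\<^esub> S) = \<Sqinter>\<^bsub>P_obj X\<^esub> (P_map X Y f ` S)"
    if S: "S \<subseteq> carrier (P_obj Y)" for S
  proof -
    have S': "S \<subseteq> Pow (topspace Y)" "topspace Y \<inter> \<Inter>S \<subseteq> topspace Y" using S by auto
    show ?thesis
      \<comment> \<open>For empty \<open>S\<close> both sides must be \<open>topspace X\<close>;
        \<open>fc\<close> ensures that the preimage of \<open>topspace Y\<close> is all of
        it.\<close>
      unfolding P_obj_Inf[OF S'(1)] P_obj_Inf[OF img(2)[OF S'(1)]] Pm[OF S'(2)]
      unfolding img(1)[OF S'(1)]
      using fc by auto
  qed
  moreover have "P_map X Y f (\<sim>\<^bsub>P_obj Y\<^esub> B) = \<sim>\<^bsub>P_obj X\<^esub> (P_map X Y f B)"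
    if "B \<in> carrier (P_obj Y)" for B
  proof -
    have B: "B \<subseteq> topspace Y" using that by simp
    have "P_map X Y f B \<subseteq> topspace X" using Pm[OF B] by auto
    then show ?thesis
      using fc by (auto simp: P_obj_compl B Pm)
  qed
  moreover have "P_map X Y f (\<box>\<^bsub>P_obj Y\<^esub> B) \<sqsubseteq>\<^bsub>P_obj X\<^esub> \<box>\<^bsub>P_obj X\<^esub> (P_map X Y f B)"
    if "B \<in> carrier (P_obj Y)" for B
  proof -
    have B: "B \<subseteq> topspace Y" using that by simp
    have "openin X {x \<in> topspace X. f x \<in> Y interior_of B}"
      using openin_continuous_map_preimage[OF cf] by simp
    moreover have "{x \<in> topspace X. f x \<in> Y interior_of B} \<subseteq> {x \<in> topspace X. f x \<in> B}"
      using interior_of_subset[of Y B] by auto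
    ultimately show ?thesis
      using B by (simp add: Pm interior_of_subset_topspace interior_of_maximal)
  qed
  moreover have "P_map X Y f K \<in> mt_KS (P_obj X)" if "K \<in> mt_KS (P_obj Y)" for K
  proof -
    have K: "compactin Y K" "saturatedin Y K" using that by (simp_all add: P_obj_KS)
    then show ?thesis
      using f saturatedin_preimage[OF cf] Pm[OF compactin_subset_topspace[OF K(1)]]
      by (simp add: P_obj_KS LCHaus_hom_def)
  qed
  ultimately show ?thesis
    by (simp add: LCHMT_hom_def mt_hom_def del: P_obj_simps)
qed

lemma P_map_id: "P_map X X (\<lambda>x\<in>topspace X. x) = (\<lambda>A\<in>carrier (P_obj X). A)"
  unfolding P_map_def P_obj_simps by (intro restrict_ext) auto

lemma P_map_compose:
  assumes "f \<in> LCHaus_hom X Y"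
  shows "P_map X Z (compose (topspace X) g f)
    = compose (carrier (P_obj Z)) (P_map X Y f) (P_map Y Z g)"
proof
  fix C
  show "P_map X Z (compose (topspace X) g f) C
    = compose (carrier (P_obj Z)) (P_map X Y f) (P_map Y Z g) C"
  proof (cases "C \<subseteq> topspace Z")
    case True
    have "{y \<in> topspace Y. g y \<in> C} \<subseteq> topspace Y" by blast
    then show ?thesis
      using True LCHaus_hom_closed[OF assms] by (auto simp: P_map_def compose_eq)
  qed (simp add: P_map_def compose_def)
qed

section \<open>The unit on spaces\<close>

text \<open>The atoms of the powerset algebra are the singletons, and the open sets of atoms are the
  images of open sets of \<open>X\<close> under the singleton map. The inverse is
  \<open>the_elem\<close>, restricted to be extensional.\<close>

lemma space_eps_homeomorphic:
  "homeomorphic_maps X (at_obj (P_obj X)) (space_eps X) (\<lambda>A\<in>topspace (at_obj (P_obj X)). the_elem A)"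
proof -
  interpret mt_algebra "P_obj X" by (rule mt_algebra_P_obj)
  have top: "topspace (at_obj (P_obj X)) = (\<lambda>x. {x}) ` topspace X"
    by (simp add: topspace_at_obj P_obj_atoms)
  have "openin (at_obj (P_obj X)) V \<longleftrightarrow> V \<in> mt_eta (P_obj X) ` {U. openin X U}" for V
    by (simp add: openin_at_obj P_obj_open)
  moreover have "mt_eta (P_obj X) U = (\<lambda>x. {x}) ` U" if "openin X U" for U
    using openin_subset[OF that] by (rule P_obj_eta)
  ultimately have open_iff: "openin (at_obj (P_obj X)) V \<longleftrightarrow> (\<exists>U. openin X U \<and> V = (\<lambda>x. {x}) ` U)" for V
    by auto
  have "continuous_map X (at_obj (P_obj X)) (space_eps X)"
    unfolding continuous_map
  proof (intro conjI allI impI)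
    show "space_eps X ` topspace X \<subseteq> topspace (at_obj (P_obj X))"
      by (auto simp: space_eps_def top)
    fix V assume "openin (at_obj (P_obj X)) V"
    then obtain U where U: "openin X U" "V = (\<lambda>x. {x}) ` U" using open_iff by auto
    then have "{x \<in> topspace X. space_eps X x \<in> V} = U"
      using openin_subset[OF U(1)] by (auto simp: space_eps_def)
    then show "openin X {x \<in> topspace X. space_eps X x \<in> V}" using U by simp
  qed
  moreover have "continuous_map (at_obj (P_obj X)) X (\<lambda>A\<in>topspace (at_obj (P_obj X)). the_elem A)"
    unfolding continuous_map
  proof (intro conjI allI impI)
    show "(\<lambda>A\<in>topspace (at_obj (P_obj X)). the_elem A) ` topspace (at_obj (P_obj X)) \<subseteq> topspace X"
      by (auto simp: top)
    fix U assume U: "openin X U"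
    then have "{A \<in> topspace (at_obj (P_obj X)). (\<lambda>A\<in>topspace (at_obj (P_obj X)). the_elem A) A \<in> U}
        = (\<lambda>x. {x}) ` U"
      using openin_subset[OF U] by (auto simp: top)
    then show "openin (at_obj (P_obj X))
        {A \<in> topspace (at_obj (P_obj X)). (\<lambda>A\<in>topspace (at_obj (P_obj X)). the_elem A) A \<in> U}"
      using U open_iff by auto
  qed
  ultimately show ?thesis
    by (auto simp: homeomorphic_maps_def top space_eps_def)
qed

text \<open>Properness is automatic here: the preimage of a compact set under \<open>f\<close> is
  its image under the continuous inverse \<open>g\<close>.\<close>

lemma homeomorphic_maps_LCHaus_hom:
  assumes h: "homeomorphic_maps X Y f g" and "f \<in> extensional (topspace X)"
  shows "f \<in> LCHaus_hom X Y"
proof -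
  have cf: "continuous_map X Y f" and cg: "continuous_map Y X g"
    and gf: "\<And>x. x \<in> topspace X \<Longrightarrow> g (f x) = x" and fg: "\<And>y. y \<in> topspace Y \<Longrightarrow> f (g y) = y"
    using h by (auto simp: homeomorphic_maps_def)
  have "compactin X {x \<in> topspace X. f x \<in> K}" if K: "compactin Y K" for K
  proof -
    have "{x \<in> topspace X. f x \<in> K} = g ` K"
    proof
      show "{x \<in> topspace X. f x \<in> K} \<subseteq> g ` K"
        using gf by force
      show "g ` K \<subseteq> {x \<in> topspace X. f x \<in> K}"
        using compactin_subset_topspace[OF K] continuous_map_image_subset_topspace[OF cg] fg by auto
    qed
    then show ?thesis
      using image_compactin[OF K cg] by simp
  qed
  then show ?thesis
    using cf assms(2) continuous_map_image_subset_topspace[OF cf]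
    by (auto simp: LCHaus_hom_def PiE_iff)
qed

lemma homeomorphic_maps_LCHaus_iso:
  assumes h: "homeomorphic_maps X Y f g"
    and ext: "f \<in> extensional (topspace X)" "g \<in> extensional (topspace Y)"
  shows "f \<in> LCHaus_iso X Y"
proof -
  have h': "homeomorphic_maps Y X g f"
    using h homeomorphic_maps_sym[of X Y f g] by blast
  have "compose (topspace X) g f = (\<lambda>x\<in>topspace X. x)"
    using h by (auto simp: compose_def homeomorphic_maps_def intro!: restrict_ext)
  moreover have "compose (topspace Y) f g = (\<lambda>y\<in>topspace Y. y)"
    using h by (auto simp: compose_def homeomorphic_maps_def intro!: restrict_ext)
  ultimately show ?thesis
    unfolding LCHaus_iso_def
    using homeomorphic_maps_LCHaus_hom[OF h ext(1)] homeomorphic_maps_LCHaus_hom[OF h' ext(2)]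
    by blast
qed

lemma space_eps_LCHaus_iso: "space_eps X \<in> LCHaus_iso X (at_obj (P_obj X))"
  by (rule homeomorphic_maps_LCHaus_iso[OF space_eps_homeomorphic]) (simp_all add: space_eps_def)

lemma space_eps_natural:
  assumes "f \<in> LCHaus_hom X Y"
  shows "compose (topspace X) (at_map (P_obj Y) (P_obj X) (P_map X Y f)) (space_eps X)
    = compose (topspace X) (space_eps Y) f"
proof
  fix x
  show "compose (topspace X) (at_map (P_obj Y) (P_obj X) (P_map X Y f)) (space_eps X) x
    = compose (topspace X) (space_eps Y) f x"
  proof (cases "x \<in> topspace X")
    case True
    then have fx: "f x \<in> topspace Y" by (rule LCHaus_hom_closed[OF assms])
    let ?A = "{B \<in> carrier (P_obj Y). {x} \<sqsubseteq>\<^bsub>P_obj X\<^esub> P_map X Y f B}"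
    have A: "?A = {B \<in> Pow (topspace Y). f x \<in> B}"
      using True by (auto simp: P_map_def)
    have "at_map (P_obj Y) (P_obj X) (P_map X Y f) {x} = \<Sqinter>\<^bsub>P_obj Y\<^esub> ?A"
      using True by (simp add: at_map_def P_obj_atoms)
    also have "\<dots> = topspace Y \<inter> \<Inter>?A"
      unfolding A by (rule P_obj_Inf) blast
    \<comment> \<open>The singleton \<open>{f x}\<close> is itself one of the sets being
      intersected.\<close>
    also have "\<dots> = {f x}"
      unfolding A using fx by auto
    finally show ?thesis
      using True fx by (simp add: compose_eq space_eps_def)
  qed (simp add: compose_def)
qed

theorem theorem6p9:
  shows
    \<comment> \<open>\<open>LCHMT\<close> is closed under identities and composition\<close>
    "(\<forall>M :: 'a mt. LCHMT M \<longrightarrow> (\<lambda>a\<in>carrier M. a) \<in> LCHMT_hom M M)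
   \<and> (\<forall>(M :: 'a mt) (N :: 'b mt) (L :: 'c mt). LCHMT M \<longrightarrow> LCHMT N \<longrightarrow> LCHMT L \<longrightarrow>
        (\<forall>f \<in> LCHMT_hom M N. \<forall>g \<in> LCHMT_hom N L. compose (carrier M) g f \<in> LCHMT_hom M L))
    \<comment> \<open>\<open>LCHaus\<close> is closed under identities and composition\<close>
   \<and> (\<forall>X :: 'x topology. LCHaus X \<longrightarrow> (\<lambda>x\<in>topspace X. x) \<in> LCHaus_hom X X)
   \<and> (\<forall>(X :: 'x topology) (Y :: 'y topology) (Z :: 'z topology).
        LCHaus X \<longrightarrow> LCHaus Y \<longrightarrow> LCHaus Z \<longrightarrow>
        (\<forall>f \<in> LCHaus_hom X Y. \<forall>g \<in> LCHaus_hom Y Z. compose (topspace X) g f \<in> LCHaus_hom X Z))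
    \<comment> \<open>\<open>at\<close> is a contravariant functor from \<open>LCHMT\<close> to \<open>LCHaus\<close>\<close>
   \<and> (\<forall>M :: 'a mt. LCHMT M \<longrightarrow> LCHaus (at_obj M))
   \<and> (\<forall>(M :: 'a mt) (N :: 'b mt). LCHMT M \<longrightarrow> LCHMT N \<longrightarrow>
        (\<forall>f \<in> LCHMT_hom M N. at_map M N f \<in> LCHaus_hom (at_obj N) (at_obj M)))
   \<and> (\<forall>M :: 'a mt. LCHMT M \<longrightarrow>
        at_map M M (\<lambda>a\<in>carrier M. a) = (\<lambda>x\<in>topspace (at_obj M). x))
   \<and> (\<forall>(M :: 'a mt) (N :: 'b mt) (L :: 'c mt). LCHMT M \<longrightarrow> LCHMT N \<longrightarrow> LCHMT L \<longrightarrow>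
        (\<forall>f \<in> LCHMT_hom M N. \<forall>g \<in> LCHMT_hom N L.
           at_map M L (compose (carrier M) g f)
             = compose (topspace (at_obj L)) (at_map M N f) (at_map N L g)))
    \<comment> \<open>\<open>P\<close> is a contravariant functor from \<open>LCHaus\<close> to \<open>LCHMT\<close>\<close>
   \<and> (\<forall>X :: 'x topology. LCHaus X \<longrightarrow> LCHMT (P_obj X))
   \<and> (\<forall>(X :: 'x topology) (Y :: 'y topology). LCHaus X \<longrightarrow> LCHaus Y \<longrightarrow>
        (\<forall>f \<in> LCHaus_hom X Y. P_map X Y f \<in> LCHMT_hom (P_obj Y) (P_obj X)))
   \<and> (\<forall>X :: 'x topology. LCHaus X \<longrightarrow>
        P_map X X (\<lambda>x\<in>topspace X. x) = (\<lambda>A\<in>carrier (P_obj X). A))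
   \<and> (\<forall>(X :: 'x topology) (Y :: 'y topology) (Z :: 'z topology).
        LCHaus X \<longrightarrow> LCHaus Y \<longrightarrow> LCHaus Z \<longrightarrow>
        (\<forall>f \<in> LCHaus_hom X Y. \<forall>g \<in> LCHaus_hom Y Z.
           P_map X Z (compose (topspace X) g f)
             = compose (carrier (P_obj Z)) (P_map X Y f) (P_map Y Z g)))
    \<comment> \<open>\<open>\<eta> : 1 \<Rightarrow> P \<circ> at\<close> is a natural isomorphism\<close>
   \<and> (\<forall>M :: 'a mt. LCHMT M \<longrightarrow> mt_eta M \<in> LCHMT_iso M (P_obj (at_obj M)))
   \<and> (\<forall>(M :: 'a mt) (N :: 'b mt). LCHMT M \<longrightarrow> LCHMT N \<longrightarrow>
        (\<forall>f \<in> LCHMT_hom M N.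
           compose (carrier M) (P_map (at_obj N) (at_obj M) (at_map M N f)) (mt_eta M)
             = compose (carrier M) (mt_eta N) f))
    \<comment> \<open>\<open>\<epsilon> : 1 \<Rightarrow> at \<circ> P\<close> is a natural isomorphism\<close>
   \<and> (\<forall>X :: 'x topology. LCHaus X \<longrightarrow> space_eps X \<in> LCHaus_iso X (at_obj (P_obj X)))
   \<and> (\<forall>(X :: 'x topology) (Y :: 'y topology). LCHaus X \<longrightarrow> LCHaus Y \<longrightarrow>
        (\<forall>f \<in> LCHaus_hom X Y.
           compose (topspace X) (at_map (P_obj Y) (P_obj X) (P_map X Y f)) (space_eps X)
             = compose (topspace X) (space_eps Y) f))"
  by (intro conjI allI impI ballI)
    (rule LCHMT_hom_id LCHMT_hom_compose LCHaus_hom_id LCHaus_hom_compose LCHaus_at_obj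
      at_map_LCHaus_hom at_map_id at_map_compose LCHMT_P_obj P_map_LCHMT_hom P_map_id
      P_map_compose eta_LCHMT_iso eta_natural space_eps_LCHaus_iso space_eps_natural; assumption)+

end
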